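(* Let $k,t$ be positive integers with $k\geq 4$, and let $\varepsilon>0$. There exist a positive real $\delta$ and an integer $n_0$ such that for all $n\geq n_0$ the following holds: if $\mathcal{F}\subseteq\binom{[n]}{k}$ contains no copy of $\mathbb{P}^{(k)}_{2t+2}$ or contains no copy of $\mathbb{P}^{(k)}_{2t+1}$, and $|\mathcal{F}|\geq(t-\delta)\binom{n}{k-1}$, then there is a set $S\subseteq[n]$ with $|S|=t$ such that all but at most $\varepsilon\binom{n}{k-1}$ members of $\mathcal{F}$ intersect $S$.
   Context: A $k$-uniform linear path of length $\ell$, $\mathbb{P}^{(k)}_\ell$, is a family of $k$-sets $\{F_1,\ldots,F_\ell\}$ with $|F_i\cap F_{i+1}|=1$ for each $i$ and $F_i\cap F_j=\emptyset$ whenever $|i-j|>1$. A family contains a copy of it if some subfamily is isomorphic to it. *)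

theory Defs
  imports Complex_Main "HOL-Library.Ramsey"
begin

definition linear_path :: "nat \<Rightarrow> nat \<Rightarrow> 'a set set \<Rightarrow> bool" where
  "linear_path k l P \<longleftrightarrow>
     (\<exists>F :: nat \<Rightarrow> 'a set.
        P = F ` {1..l} \<and> inj_on F {1..l} \<and>
        (\<forall>i\<in>{1..l}. finite (F i) \<and> card (F i) = k) \<and>
        (\<forall>i\<in>{1..<l}. card (F i \<inter> F (i + 1)) = 1) \<and>
        (\<forall>i\<in>{1..l}. \<forall>j\<in>{1..l}. \<bar>int i - int j\<bar> > 1 \<longrightarrow> F i \<inter> F j = {}))"

definition family_isomorphic :: "'a set set \<Rightarrow> 'b set set \<Rightarrow> bool" where
  "family_isomorphic A B \<longleftrightarrow>
     (\<exists>\<phi>. bij_betw \<phi> (\<Union>A) (\<Union>B) \<and> (\<lambda>e. \<phi> ` e) ` A = B)"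

text \<open>The linear path of given uniformity and length is unique up to isomorphism, so it does not
  matter which representative is chosen; one always exists on the vertex type \<^typ>\<open>nat\<close>
  when \<open>k \<ge> 2\<close>.\<close>

definition contains_linear_path :: "nat \<Rightarrow> nat \<Rightarrow> 'a set set \<Rightarrow> bool" where
  "contains_linear_path k l \<F> \<longleftrightarrow>
     (\<exists>P :: nat set set. linear_path k l P \<and> (\<exists>\<G>\<subseteq>\<F>. family_isomorphic \<G> P))"

end

(* Call a set A rich if it is the kernel of a large sunflower of F; a sequence of rich sets that
   intersect like the edges of a linear path extends greedily to a linear path of F.

   A homogeneous subfamily in the sense of Fueredi is k-partite, and its pairwise intersections
   determine an intersection-closed set J of colour types, all rich. If it has more than
   binomial(n, k-2) members, J covers all (k-2)-sets; then either J contains two singletons, which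
   gives arbitrarily long linear paths, or J contains {m} and all {m, j}. Hence all but O(n^(k-2))
   edges e have a centre c with {c} and all {c, y}, y in e, rich.

   Let N(c) be the set of y with {c} and {c, y} rich. A path c_0 y_0 c_1 ... c_t in this graph yields
   a linear path with 2t+2 edges, so the sets N(c) have linear total size, and no t+1 of them pairwise
   have large intersection. Only boundedly many hubs c have N(c) of linear size, and apart from a
   bounded set W each vertex belongs to N(c) for at most t hubs. So nearly all (k-1)-sets are
   joined to exactly t hubs, the same t for all their vertices; by convexity one t-set of hubs serves
   almost all vertices, and it is the required S. *)
theory Submission
  imports Defs
begin


section \<open>Rich sets and linear paths\<close>

text \<open>Richness uses an absolute threshold: \<open>Q\<close> depends only on k and t and is
  just large enough to place 2t+2 edges greedily. Enlarging the family preserves richness of a set,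
  whereas avoidance of an intersection type survives in subfamilies. This opposition drives the
  search for a homogeneous subfamily, and it lets rich sets found there count as rich in the whole
  family. The search is run on the edges that have no centre, so a large outcome contradicts itself.
  The condition k >= 4 is essential in the analysis of types: for k = 3 the types {}, {2} and {0, 1}
  cover every singleton, but neither alternative holds. No bound on the size of a path-free family
  is presupposed. A (k-1)-set off W extends by at most t hubs, and stability is read off from near
  equality in that count. The constants are fixed in the order \<delta>, hub threshold \<gamma>,
  then n; the number of hubs and the size of W are bounded in terms of \<gamma> alone for given k
  and t, so edges meeting W through a hub are negligible for large n.\<close>

text \<open>The finiteness of \<open>U\<close> has to be stated, since infinite sets have cardinality \<open>0\<close>.\<close>

definition rich :: "nat \<Rightarrow> 'a set set \<Rightarrow> 'a set \<Rightarrow> bool" where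
  "rich Q F A \<longleftrightarrow> (\<forall>U. finite U \<and> card U \<le> Q \<longrightarrow> (\<exists>e\<in>F. A \<subseteq> e \<and> (e - A) \<inter> U = {}))"

lemma richD:
  assumes "rich Q F A" "finite U" "card U \<le> Q"
  shows "\<exists>e\<in>F. A \<subseteq> e \<and> (e - A) \<inter> U = {}"
  using assms by (simp add: rich_def)

lemma rich_mono: "rich Q F A \<Longrightarrow> F \<subseteq> G \<Longrightarrow> rich Q G A"
  unfolding rich_def by (meson subsetD)

text \<open>Indices start at 0, and distinctness of the edges is not demanded: for uniformity at
  least 2 the intersection sizes force it.\<close>

definition path_seq :: "'a set set \<Rightarrow> nat \<Rightarrow> (nat \<Rightarrow> 'a set) \<Rightarrow> bool" where
  "path_seq F l e \<longleftrightarrow> (\<forall>i<l. e i \<in> F) \<and> (\<forall>i. Suc i < l \<longrightarrow> card (e i \<inter> e (Suc i)) = 1)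
     \<and> (\<forall>i j. Suc i < j \<and> j < l \<longrightarrow> e i \<inter> e j = {})"

lemma path_seq_mono:
  assumes "path_seq F l e" "F \<subseteq> G" "m \<le> l"
  shows "path_seq G m e"
  unfolding path_seq_def
proof (intro conjI allI impI)
  fix i assume "i < m"
  then show "e i \<in> G" using assms by (auto simp: path_seq_def)
next
  fix i assume "Suc i < m"
  then show "card (e i \<inter> e (Suc i)) = 1" using assms by (simp add: path_seq_def)
next
  fix i j assume "Suc i < j \<and> j < m"
  then show "e i \<inter> e j = {}" using assms by (simp add: path_seq_def)
qed

text \<open>The subfamily already lives on \<open>nat\<close>, so it is its own representative and
  the identity is the isomorphism.\<close>

lemma path_seq_imp_contains_linear_path:
  fixes F :: "nat set set"
  assumes F: "F \<subseteq> nsets V k" and k: "k \<ge> 2" and e: "path_seq F l e"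
  shows "contains_linear_path k l F"
proof -
  define f where "f = (\<lambda>i. e (i - 1))"
  have mem: "f i \<in> F" if "i \<in> {1..l}" for i
  proof -
    have "i - 1 < l" using that by auto
    then show ?thesis using e unfolding path_seq_def f_def by simp
  qed
  have fin: "finite (f i)" and card: "card (f i) = k" if "i \<in> {1..l}" for i
    using subsetD[OF F mem[OF that]] by (auto simp: nsets_def)
  have consec: "card (f i \<inter> f (i + 1)) = 1" if "i \<in> {1..<l}" for i
    using that e unfolding path_seq_def f_def by (cases i) auto
  have far': "f i \<inter> f j = {}" if "i \<in> {1..l}" "j \<in> {1..l}" "i + 1 < j" for i j
  proof -
    have "Suc (i - 1) < j - 1" "j - 1 < l" using that by auto
    then show ?thesis using e unfolding path_seq_def f_def by simp
  qed
  have far: "f i \<inter> f j = {}" if "i \<in> {1..l}" "j \<in> {1..l}" "\<bar>int i - int j\<bar> > 1" for i j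
    using far'[of i j] far'[of j i] that by (cases "i < j") auto
  have neq: "f i \<noteq> f j" if "i \<in> {1..l}" "j \<in> {1..l}" "i < j" for i j
  proof
    assume eq: "f i = f j"
    show False
    proof (cases "j = i + 1")
      case True
      then show False using consec[of i] card[of i] eq k that by auto
    next
      case False
      then show False using far'[of i j] card[of i] eq k that by auto
    qed
  qed
  have "inj_on f {1..l}"
    by (rule inj_onI) (metis neq linorder_neqE_nat)
  then have "linear_path k l (f ` {1..l})"
    unfolding linear_path_def using fin card consec far by blast
  moreover have "f ` {1..l} \<subseteq> F" using mem by blast
  moreover have "family_isomorphic (f ` {1..l}) (f ` {1..l})"
    unfolding family_isomorphic_def by (rule exI[of _ id]) auto
  ultimately show ?thesis
    unfolding contains_linear_path_def by blast
qed

text \<open>Greedy choice: outside its kernel each new edge avoids \<open>X\<close> and all earlier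
  edges, at most \<open>card X + l * k\<close> vertices. Disjointness is one-sided, since an earlier
  edge avoids later kernels only as far as they lie in \<open>X\<close>.\<close>

lemma rich_sequence_extend:
  assumes fin: "\<And>e. e \<in> F \<Longrightarrow> finite e \<and> card e \<le> k"
    and rich: "\<And>i. i < l \<Longrightarrow> rich Q F (A i)" and X: "finite X" "card X + l * k \<le> Q"
  shows "\<exists>e. (\<forall>i<l. e i \<in> F \<and> A i \<subseteq> e i \<and> (e i - A i) \<inter> X = {}) \<and>
     (\<forall>i j. i < j \<and> j < l \<longrightarrow> (e j - A j) \<inter> e i = {})"
  using rich X(2)
proof (induction l)
  case 0
  then show ?case by auto
next
  case (Suc l)
  have "\<exists>e. (\<forall>i<l. e i \<in> F \<and> A i \<subseteq> e i \<and> (e i - A i) \<inter> X = {}) \<and>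
     (\<forall>i j. i < j \<and> j < l \<longrightarrow> (e j - A j) \<inter> e i = {})"
    by (rule Suc.IH) (use Suc.prems in auto)
  then obtain e where e: "\<forall>i<l. e i \<in> F \<and> A i \<subseteq> e i \<and> (e i - A i) \<inter> X = {}"
     "\<forall>i j. i < j \<and> j < l \<longrightarrow> (e j - A j) \<inter> e i = {}"
    by blast
  let ?U = "X \<union> (\<Union>i<l. e i)"
  have "card (\<Union>i<l. e i) \<le> (\<Sum>i<l. card (e i))"
    by (rule card_UN_le) auto
  also have "\<dots> \<le> (\<Sum>i<l. k)"
    by (rule sum_mono) (use fin e in auto)
  finally have "card ?U \<le> Q"
    using Suc.prems(2) card_Un_le[of X "\<Union>i<l. e i"] by simp
  moreover have "finite ?U" using X(1) fin e by auto
  ultimately have "\<exists>f\<in>F. A l \<subseteq> f \<and> (f - A l) \<inter> ?U = {}"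
    using Suc.prems(1)[OF lessI] by (intro richD)
  then obtain f where f: "f \<in> F" "A l \<subseteq> f" "(f - A l) \<inter> ?U = {}" by blast
  let ?e = "e(l := f)"
  have "?e i \<in> F \<and> A i \<subseteq> ?e i \<and> (?e i - A i) \<inter> X = {}" if "i < Suc l" for i
  proof (cases "i = l")
    case True
    then show ?thesis using f by auto
  next
    case False
    then show ?thesis using e(1) that by simp
  qed
  moreover have "(?e j - A j) \<inter> ?e i = {}" if "i < j" "j < Suc l" for i j
  proof (cases "j = l")
    case True
    then show ?thesis using f(3) that by auto
  next
    case False
    then show ?thesis using e(2) that by simp
  qed
  ultimately show ?case by blast
qed

text \<open>With all kernels put into \<open>X\<close>, the greedy choice becomes symmetric and
  edges meet exactly where their kernels do. In \<open>2 * l * k\<close> one half pays for the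
  kernels, the other for the edges.\<close>

lemma rich_sequence_edges:
  assumes fin: "\<And>e. e \<in> F \<Longrightarrow> finite e \<and> card e \<le> k"
    and rich: "\<And>i. i < l \<Longrightarrow> rich Q F (A i)"
    and A: "\<And>i. i < l \<Longrightarrow> finite (A i) \<and> card (A i) \<le> k" and Q: "2 * l * k \<le> Q"
  shows "\<exists>e. (\<forall>i<l. e i \<in> F) \<and> (\<forall>i j. i < j \<and> j < l \<longrightarrow> e i \<inter> e j = A i \<inter> A j)"
proof -
  let ?X = "\<Union>i<l. A i"
  have "card ?X \<le> (\<Sum>i<l. card (A i))" by (rule card_UN_le) auto
  also have "\<dots> \<le> (\<Sum>i<l. k)" by (rule sum_mono) (use A in auto)
  finally have "card ?X + l * k \<le> Q" using Q by simp
  moreover have "finite ?X" using A by auto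
  ultimately have "\<exists>e. (\<forall>i<l. e i \<in> F \<and> A i \<subseteq> e i \<and> (e i - A i) \<inter> ?X = {}) \<and>
     (\<forall>i j. i < j \<and> j < l \<longrightarrow> (e j - A j) \<inter> e i = {})"
    using fin rich by (intro rich_sequence_extend)
  then obtain e where e: "\<forall>i<l. e i \<in> F \<and> A i \<subseteq> e i \<and> (e i - A i) \<inter> ?X = {}"
    "\<forall>i j. i < j \<and> j < l \<longrightarrow> (e j - A j) \<inter> e i = {}"
    by blast
  have "e i \<inter> e j = A i \<inter> A j" if "i < j" "j < l" for i j
  proof -
    have "i < l" using that by simp
    then have "A i \<subseteq> e i" "(e i - A i) \<inter> ?X = {}" "A j \<subseteq> e j"
      using e(1) that(2) by blast+
    moreover have "A j \<subseteq> ?X" using that(2) by blast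
    ultimately have "(e i - A i) \<inter> A j = {}" by (meson disjoint_iff subsetD)
    moreover have "(e j - A j) \<inter> e i = {}" using e(2) that by simp
    ultimately show ?thesis using \<open>A i \<subseteq> e i\<close> \<open>A j \<subseteq> e j\<close> by blast
  qed
  moreover have "e i \<in> F" if "i < l" for i using e(1) that by simp
  ultimately show ?thesis by blast
qed

text \<open>The kernels are \<open>{w 0}\<close>, the \<open>m\<close> consecutive pairs and
  \<open>{w m}\<close>. The singletons add one edge at each end, so \<open>2 * t\<close> pairs yield
  \<open>2 * t + 2\<close> edges.\<close>

lemma rich_walk_path_seq:
  assumes fin: "\<And>e. e \<in> F \<Longrightarrow> finite e \<and> card e \<le> k" and k: "k \<ge> 2"
    and Q: "2 * (m + 2) * k \<le> Q" and inj: "inj_on w {..m}"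
    and ends: "rich Q F {w 0}" "rich Q F {w m}"
    and rich: "\<And>i. i < m \<Longrightarrow> rich Q F {w i, w (Suc i)}"
  shows "\<exists>e. path_seq F (m + 2) e"
proof -
  \<comment> \<open>Truncated subtraction gives \<open>N 0 = {0}\<close> and the cut at
    \<open>m\<close> gives \<open>N (Suc m) = {m}\<close>, so one formula covers the pairs and both
    singletons.\<close>
  define N where "N = (\<lambda>j::nat. {j - 1..j} \<inter> {..m})"
  define A where "A = (\<lambda>j. w ` N j)"
  have richA: "rich Q F (A j)" if "j < m + 2" for j
  proof -
    have "j = 0 \<or> j = Suc m \<or> (\<exists>i<m. j = Suc i)"
      using that by (cases j) auto
    then consider "j = 0" | "j = Suc m" | i where "i < m" "j = Suc i" by blast
    then show ?thesis
    proof cases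
      case 1
      then have "N j = {0}" by (auto simp: N_def)
      then show ?thesis using ends by (simp add: A_def)
    next
      case 2
      then have "N j = {m}" by (auto simp: N_def)
      then show ?thesis using ends by (simp add: A_def)
    next
      case 3
      then have "N j = {i, Suc i}" by (auto simp: N_def)
      then show ?thesis using rich[OF 3(1)] by (simp add: A_def)
    qed
  qed
  have cardA: "finite (A j) \<and> card (A j) \<le> k" for j
  proof -
    have "card (N j) \<le> card {j - 1..j}" unfolding N_def by (rule card_mono) auto
    also have "\<dots> \<le> k" using k by auto
    finally show ?thesis
      unfolding A_def using card_image_le[of "N j" w] by (simp add: N_def)
  qed
  have "\<exists>e. (\<forall>i<m + 2. e i \<in> F) \<and>
      (\<forall>i j. i < j \<and> j < m + 2 \<longrightarrow> e i \<inter> e j = A i \<inter> A j)"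
    by (rule rich_sequence_edges[OF fin richA cardA Q])
  then obtain e where e: "\<And>i. i < m + 2 \<Longrightarrow> e i \<in> F"
    "\<And>i j. i < j \<Longrightarrow> j < m + 2 \<Longrightarrow> e i \<inter> e j = A i \<inter> A j"
    by blast
  have AA: "A i \<inter> A j = w ` (N i \<inter> N j)" for i j
    unfolding A_def by (rule inj_on_image_Int[OF inj, symmetric]) (auto simp: N_def)
  have "card (e i \<inter> e (Suc i)) = 1" if "Suc i < m + 2" for i
  proof -
    have "N i \<inter> N (Suc i) = {i}" using that by (auto simp: N_def)
    then show ?thesis using e(2)[of i "Suc i"] that by (simp add: AA)
  qed
  moreover have "e i \<inter> e j = {}" if "Suc i < j" "j < m + 2" for i j
  proof -
    have "N i \<inter> N j = {}" using that by (auto simp: N_def)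
    then show ?thesis using e(2)[of i j] that by (simp add: AA)
  qed
  ultimately show ?thesis unfolding path_seq_def using e(1) by blast
qed

text \<open>The tip \<open>y\<close> is a rich vertex that lies on the last edge only. An edge
  through \<open>y\<close> that is otherwise new has a second rich vertex, which becomes the next
  tip; only \<open>Q\<close> limits the length.\<close>

lemma two_rich_vertices_path_seq:
  assumes fin: "\<And>e. e \<in> F \<Longrightarrow> finite e \<and> card e \<le> k" and ne: "F \<noteq> {}"
    and two: "\<And>e. e \<in> F \<Longrightarrow> \<exists>a\<in>e. \<exists>b\<in>e. a \<noteq> b \<and> rich Q F {a} \<and> rich Q F {b}"
    and Q: "l * k \<le> Q"
  shows "\<exists>e y. path_seq F (Suc l) e \<and> y \<in> e l \<and> rich Q F {y} \<and> (\<forall>i<l. y \<notin> e i)"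
  using Q
proof (induction l)
  case 0
  from ne obtain f where f: "f \<in> F" by blast
  then obtain a where "a \<in> f" "rich Q F {a}" using two by blast
  then have "path_seq F (Suc 0) (\<lambda>_. f) \<and> a \<in> f \<and> rich Q F {a} \<and> (\<forall>i<0::nat. a \<notin> f)"
    using f by (simp add: path_seq_def)
  then show ?case by (intro exI[of _ "\<lambda>_. f"] exI[of _ a]) simp
next
  case (Suc l)
  then obtain e y where e: "path_seq F (Suc l) e" "y \<in> e l" "rich Q F {y}" "\<forall>i<l. y \<notin> e i"
    by auto
  have mem: "e i \<in> F" if "i < Suc l" for i using e(1) that by (auto simp: path_seq_def)
  let ?U = "\<Union>i<Suc l. e i"
  have "card ?U \<le> (\<Sum>i<Suc l. card (e i))" by (rule card_UN_le) auto
  also have "\<dots> \<le> (\<Sum>i<Suc l. k)" by (rule sum_mono) (use fin mem in auto)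
  finally have "card ?U \<le> Q" using Suc.prems by simp
  moreover have "finite ?U" using fin mem by auto
  ultimately have "\<exists>f\<in>F. {y} \<subseteq> f \<and> (f - {y}) \<inter> ?U = {}"
    using e(3) by (intro richD)
  then obtain f where f: "f \<in> F" "{y} \<subseteq> f" "(f - {y}) \<inter> ?U = {}" by blast
  obtain z where z: "z \<in> f" "z \<noteq> y" "rich Q F {z}" using two[OF f(1)] by metis
  define g where "g = e(Suc l := f)"
  have int_l: "e l \<inter> f = {y}" using f e(2) by auto
  have int_i: "e i \<inter> f = {}" if "i < l" for i
  proof -
    have "y \<notin> e i" "e i \<subseteq> ?U" using e(4) that by (auto intro: less_SucI)
    then show ?thesis using f(3) by blast
  qed
  have "path_seq F (Suc (Suc l)) g"
    unfolding path_seq_def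
  proof (intro conjI allI impI)
    fix i assume "i < Suc (Suc l)"
    then show "g i \<in> F" using mem f(1) by (auto simp: g_def less_Suc_eq)
  next
    fix i assume "Suc i < Suc (Suc l)"
    then show "card (g i \<inter> g (Suc i)) = 1"
      using e(1) int_l by (cases "i = l") (auto simp: g_def path_seq_def)
  next
    fix i j assume "Suc i < j \<and> j < Suc (Suc l)"
    then show "g i \<inter> g j = {}"
      using e(1) int_i by (cases "j = Suc l") (auto simp: g_def path_seq_def)
  qed
  moreover have "z \<notin> g i" if "i < Suc l" for i
  proof -
    have "e i \<subseteq> ?U" using that by blast
    then show ?thesis using z f(3) that by (auto simp: g_def)
  qed
  moreover have "z \<in> g (Suc l)" using z by (simp add: g_def)
  ultimately show ?case using z(3) by blast
qed


section \<open>Homogeneous subfamilies\<close>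

definition restr :: "('a \<Rightarrow> nat) \<Rightarrow> 'a set \<Rightarrow> nat set \<Rightarrow> 'a set" where
  "restr \<chi> e A = {x \<in> e. \<chi> x \<in> A}"

definition avoids_type :: "('a \<Rightarrow> nat) \<Rightarrow> 'a set set \<Rightarrow> nat set \<Rightarrow> bool" where
  "avoids_type \<chi> F A \<longleftrightarrow> (\<forall>e\<in>F. \<forall>e'\<in>F. e \<noteq> e' \<longrightarrow> \<chi> ` (e \<inter> e') \<noteq> A)"

definition rich_type :: "nat \<Rightarrow> ('a \<Rightarrow> nat) \<Rightarrow> 'a set set \<Rightarrow> nat set \<Rightarrow> bool" where
  "rich_type Q \<chi> F A \<longleftrightarrow> (\<forall>e\<in>F. rich Q F (restr \<chi> e A))"

lemma avoids_type_mono: "avoids_type \<chi> F A \<Longrightarrow> G \<subseteq> F \<Longrightarrow> avoids_type \<chi> G A"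
  unfolding avoids_type_def by (meson subsetD)

lemma restr_eq_Int:
  assumes "inj_on \<chi> e" "\<chi> ` (e \<inter> f) = A"
  shows "restr \<chi> e A = e \<inter> f"
  using assms unfolding restr_def by (force dest: inj_onD)

text \<open>If the kernel \<open>restr \<chi> e A\<close> of some edge is not rich, all edges with this kernel meet a small
  set, so a constant fraction of them shares a vertex outside the kernel and avoids the type \<open>A\<close>.
  Moving the whole class to \<open>D A\<close> at once keeps the kernels of different steps distinct.\<close>

lemma rich_decomposition:
  fixes F :: "'a set set"
  assumes fin: "finite F" and inj: "\<And>e. e \<in> F \<Longrightarrow> inj_on \<chi> e"
  shows "\<exists>G D D'. (\<forall>A\<in>\<T>. rich_type Q \<chi> G A) \<and> F = G \<union> (\<Union>A\<in>\<T>. D A) \<and>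
     (\<forall>A\<in>\<T>. D' A \<subseteq> D A \<and> card (D A) \<le> Q * card (D' A) \<and> avoids_type \<chi> (D' A) A)"
  using assms
proof (induction "card F" arbitrary: F rule: less_induct)
  case less
  show ?case
  proof (cases "\<forall>A\<in>\<T>. rich_type Q \<chi> F A")
    case True
    then show ?thesis
      by (intro exI[of _ F] exI[of _ "\<lambda>_. {}"]) (auto simp: avoids_type_def)
  next
    case False
    then obtain A e where A: "A \<in> \<T>" and e: "e \<in> F" and nr: "\<not> rich Q F (restr \<chi> e A)"
      by (auto simp: rich_type_def)
    define B where "B = restr \<chi> e A"
    from nr obtain U where U: "finite U" "card U \<le> Q"
      "\<And>f. f \<in> F \<Longrightarrow> B \<subseteq> f \<Longrightarrow> (f - B) \<inter> U \<noteq> {}"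
      unfolding rich_def B_def by meson
    define R where "R = {f \<in> F. restr \<chi> f A = B}"
    have eR: "e \<in> R" using e by (simp add: R_def B_def)
    have R: "R \<subseteq> F" "finite R" using less.prems(1) by (auto simp: R_def)
    have "card (F - R) < card F"
      using eR R less.prems(1) by (intro psubset_card_mono) auto
    then have "\<exists>G D D'. (\<forall>A\<in>\<T>. rich_type Q \<chi> G A) \<and> F - R = G \<union> (\<Union>A\<in>\<T>. D A) \<and>
      (\<forall>A\<in>\<T>. D' A \<subseteq> D A \<and> card (D A) \<le> Q * card (D' A) \<and> avoids_type \<chi> (D' A) A)"
      by (rule less.hyps) (use less.prems in auto)
    then obtain G D D' where IH: "\<forall>A\<in>\<T>. rich_type Q \<chi> G A" "F - R = G \<union> (\<Union>A\<in>\<T>. D A)"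
      "\<forall>A\<in>\<T>. D' A \<subseteq> D A \<and> card (D A) \<le> Q * card (D' A) \<and> avoids_type \<chi> (D' A) A"
      by (elim exE conjE)
    define Ru where "Ru = (\<lambda>u. {f \<in> R. u \<in> f - B})"
    have "R \<subseteq> (\<Union>u\<in>U. Ru u)"
    proof
      fix f assume f: "f \<in> R"
      then have "B \<subseteq> f" by (auto simp: R_def restr_def)
      then show "f \<in> (\<Union>u\<in>U. Ru u)" using U(3)[of f] f R by (auto simp: Ru_def)
    qed
    then have "card R \<le> card (\<Union>u\<in>U. Ru u)"
      using U(1) R by (intro card_mono) (auto simp: Ru_def)
    also have "\<dots> \<le> (\<Sum>u\<in>U. card (Ru u))" by (rule card_UN_le[OF U(1)])
    finally have cR: "card R \<le> (\<Sum>u\<in>U. card (Ru u))" .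
    have "\<exists>u\<in>U. card R \<le> Q * card (Ru u)"
    proof (rule ccontr)
      assume "\<not> ?thesis"
      then have lt: "\<And>u. u \<in> U \<Longrightarrow> Q * card (Ru u) < card R" by (simp add: not_le)
      have "card R > 0" using eR R by (auto simp: card_gt_0_iff)
      then have "U \<noteq> {}" using cR by auto
      then have "(\<Sum>u\<in>U. Q * card (Ru u)) < (\<Sum>u\<in>U. card R)"
        using U(1) lt by (intro sum_strict_mono) auto
      also have "\<dots> \<le> Q * card R" using U(2) by simp
      also have "\<dots> \<le> (\<Sum>u\<in>U. Q * card (Ru u))"
        using mult_le_mono2[OF cR] by (simp add: sum_distrib_left)
      finally show False by simp
    qed
    then obtain u where u: "u \<in> U" "card R \<le> Q * card (Ru u)" by blast
    have DFR: "D A \<subseteq> F - R" using A by (simp add: IH(2) UN_upper le_supI2)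
    have D'D: "D' A \<subseteq> D A" using IH(3) A by simp
    then have D'F: "D' A \<subseteq> F - R" using DFR by simp
    have finF: "finite (D A)" "finite (D' A)"
      using less.prems(1) DFR D'F by (meson finite_Diff finite_subset)+
    have RuR: "Ru u \<subseteq> R" by (auto simp: Ru_def)
    have av: "avoids_type \<chi> (D' A \<union> Ru u) A"
      unfolding avoids_type_def
    proof (intro ballI impI notI)
      fix f f' assume f: "f \<in> D' A \<union> Ru u" "f' \<in> D' A \<union> Ru u" "f \<noteq> f'" and eq: "\<chi> ` (f \<inter> f') = A"
      have FF: "f \<in> F" "f' \<in> F" using f D'F RuR R by auto
      have r: "restr \<chi> f A = f \<inter> f'" "restr \<chi> f' A = f \<inter> f'"
        using restr_eq_Int[OF less.prems(2)[OF FF(1)] eq] restr_eq_Int[of \<chi> f' f A] less.prems(2)[OF FF(2)] eq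
        by (simp_all add: Int_commute)
      \<comment> \<open>An intersection of type \<open>A\<close> is the type-\<open>A\<close> kernel
        of both edges, so it cannot link the class \<open>R\<close> with edges removed in other
        steps.\<close>
      have "f \<in> R \<longleftrightarrow> f' \<in> R" using FF r by (simp add: R_def)
      then consider "f \<in> D' A" "f' \<in> D' A" | "f \<in> Ru u" "f' \<in> Ru u"
        using f D'F RuR by blast
      then show False
      proof cases
        case 1
        moreover have "avoids_type \<chi> (D' A) A" using IH(3) A by simp
        ultimately show False using f(3) eq by (simp add: avoids_type_def)
      next
        case 2
        then have "f \<inter> f' = B" using r by (simp add: Ru_def R_def)
        then show False using 2 by (auto simp: Ru_def)
      qed
    qed
    have "card (D A \<union> R) = card (D A) + card R"
      using finF R DFR by (intro card_Un_disjoint) auto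
    moreover have "card (D' A \<union> Ru u) = card (D' A) + card (Ru u)"
      using finF R D'F RuR finite_subset[OF RuR] by (intro card_Un_disjoint) auto
    moreover have "card (D A) \<le> Q * card (D' A)" using IH(3) A by simp
    ultimately have "card (D A \<union> R) \<le> Q * card (D' A \<union> Ru u)"
      using u(2) by (simp add: distrib_left)
    moreover have "D' A \<union> Ru u \<subseteq> D A \<union> R" using RuR D'D by blast
    ultimately have 1: "\<forall>A'\<in>\<T>. (D'(A := D' A \<union> Ru u)) A' \<subseteq> (D(A := D A \<union> R)) A' \<and>
        card ((D(A := D A \<union> R)) A') \<le> Q * card ((D'(A := D' A \<union> Ru u)) A') \<and>
        avoids_type \<chi> ((D'(A := D' A \<union> Ru u)) A') A'"
      using IH(3) av by auto
    have "(\<Union>A'\<in>\<T>. (D(A := D A \<union> R)) A') = (\<Union>A\<in>\<T>. D A) \<union> R"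
      using A by auto
    moreover have "F = (F - R) \<union> R" using R(1) by auto
    ultimately have 2: "F = G \<union> (\<Union>A'\<in>\<T>. (D(A := D A \<union> R)) A')"
      by (simp only: IH(2) Un_assoc)
    show ?thesis
      by (rule exI[of _ G], rule exI[of _ "D(A := D A \<union> R)"], rule exI[of _ "D'(A := D' A \<union> Ru u)"])
        (intro conjI IH(1) 1 2)
  qed
qed

text \<open>If the part \<open>G\<close> of the decomposition is too small, some \<open>D' A\<close>
  holds a fraction \<open>1 / c\<close> of \<open>F\<close>. There \<open>A\<close> is avoided for
  good, as subfamilies keep avoiding it, and one type fewer remains. The size of \<open>c\<close>
  comes from the pigeonhole over \<open>G\<close> and the sets \<open>D A\<close>, which needs
  \<open>1 + Q * card \<T> \<le> c\<close>; each round costs one factor \<open>c\<close>.\<close>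

lemma homogeneous_subfamily:
  fixes F :: "'a set set"
  assumes "finite F" and "\<And>e. e \<in> F \<Longrightarrow> inj_on \<chi> e"
    and "finite \<T>" and c: "c \<ge> (card \<T> + 1) * (Q + 1)"
  shows "\<exists>G\<subseteq>F. card F \<le> c ^ (card \<T> + 1) * card G \<and>
     (\<forall>A\<in>\<T>. avoids_type \<chi> G A \<or> rich_type Q \<chi> G A)"
  using assms
proof (induction "card \<T>" arbitrary: F \<T>)
  case 0
  then have "\<T> = {}" by simp
  moreover have "card F \<le> c * card F" using 0 by simp
  ultimately show ?case by (intro exI[of _ F]) auto
next
  case (Suc m)
  obtain G D D' where D: "\<forall>A\<in>\<T>. rich_type Q \<chi> G A" "F = G \<union> (\<Union>A\<in>\<T>. D A)"
    "\<forall>A\<in>\<T>. D' A \<subseteq> D A \<and> card (D A) \<le> Q * card (D' A) \<and> avoids_type \<chi> (D' A) A"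
    using rich_decomposition[OF Suc.prems(1,2)] by metis
  have c1: "c \<ge> 1" using Suc.prems(4) by simp
  have pw: "c \<le> c ^ (card \<T> + 1)" using c1 by simp
  show ?case
  proof (cases "card F \<le> c * card G")
    case True
    then have "card F \<le> c ^ (card \<T> + 1) * card G"
      using pw by (meson le_trans mult_le_mono1)
    then show ?thesis using D(1,2) by (intro exI[of _ G]) auto
  next
    case False
    have "\<exists>A\<in>\<T>. card F \<le> c * card (D' A)"
    proof (rule ccontr)
      assume "\<not> ?thesis"
      then have lt: "\<And>A. A \<in> \<T> \<Longrightarrow> c * card (D' A) \<le> card F" by (meson nat_le_linear)
      have "card F \<le> card G + card (\<Union>A\<in>\<T>. D A)" using D(2) card_Un_le by metis
      also have "card (\<Union>A\<in>\<T>. D A) \<le> (\<Sum>A\<in>\<T>. card (D A))" by (rule card_UN_le[OF Suc.prems(3)])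
      also have "\<dots> \<le> (\<Sum>A\<in>\<T>. Q * card (D' A))" by (rule sum_mono) (use D(3) in blast)
      finally have "card F \<le> card G + (\<Sum>A\<in>\<T>. Q * card (D' A))" by simp
      from mult_le_mono2[OF this, of c]
      have le: "c * card F \<le> c * card G + Q * (\<Sum>A\<in>\<T>. c * card (D' A))"
        by (simp add: sum_distrib_left distrib_left mult.left_commute)
      have "(\<Sum>A\<in>\<T>. c * card (D' A)) \<le> card \<T> * card F"
        using sum_mono[of \<T> "\<lambda>A. c * card (D' A)" "\<lambda>_. card F"] lt by simp
      then have "c * card F \<le> c * card G + Q * (card \<T> * card F)"
        using le by (meson add_left_mono le_trans mult_le_mono2)
      also have "\<dots> < card F + Q * (card \<T> * card F)" using False by simp
      also have "\<dots> = (1 + Q * card \<T>) * card F" by (simp add: algebra_simps)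
      also have "\<dots> \<le> c * card F"
        using Suc.prems(4) by (intro mult_le_mono1) (simp add: algebra_simps)
      finally show False by simp
    qed
    then obtain A where A: "A \<in> \<T>" "card F \<le> c * card (D' A)" by blast
    have sub: "D' A \<subseteq> F" using D(2,3) A by blast
    have cT: "card (\<T> - {A}) = m" using Suc A by simp
    have "\<exists>H\<subseteq>D' A. card (D' A) \<le> c ^ (card (\<T> - {A}) + 1) * card H \<and>
       (\<forall>A\<in>\<T> - {A}. avoids_type \<chi> H A \<or> rich_type Q \<chi> H A)"
    proof (rule Suc.hyps(1))
      show "m = card (\<T> - {A})" using cT by simp
      show "finite (D' A)" using sub Suc.prems(1) by (rule finite_subset)
      show "inj_on \<chi> e" if "e \<in> D' A" for e using that sub Suc.prems(2) by blast
      show "finite (\<T> - {A})" using Suc.prems(3) by simp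
      have "(card (\<T> - {A}) + 1) * (Q + 1) \<le> (card \<T> + 1) * (Q + 1)"
        using cT Suc.hyps(2) by (intro mult_le_mono1) simp
      then show "(card (\<T> - {A}) + 1) * (Q + 1) \<le> c" using Suc.prems(4) by simp
    qed
    then obtain H where H: "H \<subseteq> D' A" "card (D' A) \<le> c ^ (m + 1) * card H"
       "\<forall>A\<in>\<T> - {A}. avoids_type \<chi> H A \<or> rich_type Q \<chi> H A"
      using cT by auto
    have "card F \<le> c * (c ^ (m + 1) * card H)"
      using A(2) H(2) by (meson le_trans mult_le_mono2)
    then have "card F \<le> c ^ (card \<T> + 1) * card H"
      by (simp add: Suc.hyps(2)[symmetric] mult.assoc)
    moreover have "avoids_type \<chi> H A"
      using D(3) A(1) H(1) avoids_type_mono by blast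
    then have "\<forall>A'\<in>\<T>. avoids_type \<chi> H A' \<or> rich_type Q \<chi> H A'"
      using H(3) by (metis Diff_iff singletonD)
    moreover have "H \<subseteq> F" using H(1) sub by simp
    ultimately show ?thesis by meson
  qed
qed


text \<open>After complementation, unions of members are members and every pair contains a nonempty
  member. The outcome depends on the number of indices whose singleton is not the complement of a
  type: exactly one such index becomes the \<open>m\<close> of the second alternative, any other
  number leads to the first.\<close>

lemma Int_closed_types:
  fixes J :: "nat set set"
  assumes J: "J \<subseteq> Pow {..<k}" "{..<k} \<notin> J" and Int: "\<And>A B. A \<in> J \<Longrightarrow> B \<in> J \<Longrightarrow> A \<inter> B \<in> J"
    and cover: "\<And>T. T \<subseteq> {..<k} \<Longrightarrow> card T = k - 2 \<Longrightarrow> \<exists>A\<in>J. T \<subseteq> A" and k: "k \<ge> 4"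
  shows "(\<exists>a<k. \<exists>b<k. a \<noteq> b \<and> {a} \<in> J \<and> {b} \<in> J) \<or> (\<exists>m<k. {m} \<in> J \<and> (\<forall>j<k. {m, j} \<in> J))"
proof -
  define I where "I = {..<k}"
  have finI: "finite I" and cardI: "card I = k" by (simp_all add: I_def)
  \<comment> \<open>Complements turn the intersection-closed family into a union-closed one.\<close>
  define D where "D = {X. X \<subseteq> I \<and> I - X \<in> J}"
  have DUn: "X \<union> Y \<in> D" if "X \<in> D" "Y \<in> D" for X Y
  proof -
    have "I - (X \<union> Y) = (I - X) \<inter> (I - Y)" by blast
    then show ?thesis using Int that by (simp add: D_def)
  qed
  have DUnion: "\<Union>\<C> \<in> D" if "finite \<C>" "\<C> \<noteq> {}" "\<C> \<subseteq> D" for \<C>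
    using that by (induction rule: finite_ne_induct) (simp_all add: DUn)
  have Dlocal: "X \<in> D" if X: "X \<noteq> {}" "X \<subseteq> I" and loc: "\<And>x. x \<in> X \<Longrightarrow> \<exists>Y\<in>D. x \<in> Y \<and> Y \<subseteq> X" for X
  proof -
    define \<C> where "\<C> = {Y \<in> D. Y \<subseteq> X}"
    have U: "\<Union>\<C> = X"
    proof (intro equalityI subsetI)
      fix x assume "x \<in> X"
      then obtain Y where "Y \<in> D" "x \<in> Y" "Y \<subseteq> X" using loc by meson
      then show "x \<in> \<Union>\<C>" by (auto simp: \<C>_def)
    qed (auto simp: \<C>_def)
    then have "\<C> \<noteq> {}" using X(1) by auto
    moreover have "finite \<C>"
      using finite_subset[OF X(2) finI] by (auto simp: \<C>_def intro: rev_finite_subset[of "Pow X"])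
    moreover have "\<C> \<subseteq> D" by (simp add: \<C>_def)
    ultimately show ?thesis using DUnion U by metis
  qed
  have pair: "{i} \<in> D \<or> {j} \<in> D \<or> {i, j} \<in> D" if ij: "i \<in> I" "j \<in> I" "i \<noteq> j" for i j
  proof -
    have "card (I - {i, j}) = k - 2" using ij finI cardI by (simp add: card_Diff_subset)
    then obtain A where A: "A \<in> J" "I - {i, j} \<subseteq> A" using cover[of "I - {i, j}"] by (auto simp: I_def)
    have "A \<subseteq> I" "A \<noteq> I" using A(1) J by (auto simp: I_def)
    then have "I - A \<noteq> {}" "I - A \<subseteq> {i, j}" "I - (I - A) = A" using A(2) by auto
    then have "I - A \<in> D" using A(1) by (simp add: D_def)
    moreover have "I - A = {i} \<or> I - A = {j} \<or> I - A = {i, j}"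
      using \<open>I - A \<noteq> {}\<close> \<open>I - A \<subseteq> {i, j}\<close> by (metis subset_insert subset_singletonD insert_absorb
          insert_commute subset_antisym empty_subsetI insert_subset)
    ultimately show ?thesis by metis
  qed
  \<comment> \<open>Outside \<open>B\<close> singletons lie in \<open>D\<close>, and by
    \<open>pair\<close> any two elements of \<open>B\<close> form a member of \<open>D\<close>. So
    only a set that meets \<open>B\<close> in exactly one element can fail to be a union of
    members.\<close>
  define B where "B = {i \<in> I. {i} \<notin> D}"
  have big: "X \<in> D" if X: "X \<noteq> {}" "X \<subseteq> I" "card (X \<inter> B) \<noteq> 1" for X
  proof (rule Dlocal[OF X(1,2)])
    fix x assume x: "x \<in> X"
    show "\<exists>Y\<in>D. x \<in> Y \<and> Y \<subseteq> X"
    proof (cases "x \<in> B")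
      case False
      then have "{x} \<in> D" using x X(2) by (auto simp: B_def)
      then show ?thesis using x by blast
    next
      case True
      then have "X \<inter> B \<noteq> {x}" using X(3) by auto
      then obtain j where j: "j \<in> X" "j \<in> B" "j \<noteq> x" using True x by blast
      then have "{x, j} \<in> D" using pair[of x j] True x X(2) by (auto simp: B_def)
      then show ?thesis using x j by blast
    qed
  qed
  have D_J: "A \<in> J" if "I - A \<in> D" "A \<subseteq> I" for A
    using that by (simp add: D_def double_diff)
  have BI: "B \<subseteq> I" by (auto simp: B_def)
  have finB: "finite B" using BI finI by (rule finite_subset)
  have large: "I - A \<noteq> {}" if "card A \<le> 2" "A \<subseteq> I" for A
    using that k cardI by auto
  have sing: "{a} \<in> J" if "a \<in> I" "card (B - {a}) \<noteq> 1" for a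
  proof (rule D_J[OF big])
    show "I - {a} \<noteq> {}" using large[of "{a}"] that by simp
    have "(I - {a}) \<inter> B = B - {a}" using BI by blast
    then show "card ((I - {a}) \<inter> B) \<noteq> 1" using that by simp
  qed (use that in auto)
  consider "card B = 1" | "card B = 2" | "card B = 0 \<or> card B \<ge> 3" by linarith
  then show ?thesis
  proof cases
    case 1
    then obtain m where m: "B = {m}" by (auto simp: card_1_singleton_iff)
    then have mI: "m \<in> I" using BI by simp
    have "{m, j} \<in> J" if "j \<in> I" for j
    proof (rule D_J[OF big])
      show "I - {m, j} \<noteq> {}" using large[of "{m, j}"] mI that by (simp add: card_insert_if)
      have "(I - {m, j}) \<inter> B = {}" using m by auto
      then show "card ((I - {m, j}) \<inter> B) \<noteq> 1" by simp
    qed (use mI that in auto)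
    moreover have "{m} \<in> J" using sing[OF mI] m by simp
    ultimately show ?thesis using mI by (auto simp: I_def)
  next
    case 2
    \<comment> \<open>This is where \<open>k \<ge> 4\<close> matters: two elements of
      \<open>B\<close> must leave two further indices.\<close>
    have "card (I - B) \<ge> 2" using card_Diff_subset[OF finB BI] 2 cardI k by simp
    then obtain a b where ab: "a \<in> I - B" "b \<in> I - B" "a \<noteq> b"
      by (metis obtain_subset_with_card_n card_2_iff insert_subset)
    then have "B - {a} = B" "B - {b} = B" by auto
    then have "{a} \<in> J" "{b} \<in> J" using sing[of a] sing[of b] ab 2 by auto
    then show ?thesis using ab by (auto simp: I_def)
  next
    case 3
    have "{a} \<in> J" if "a \<in> I" for a
    proof (rule sing[OF that])
      show "card (B - {a}) \<noteq> 1" using 3 finB by (cases "a \<in> B") auto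
    qed
    then have "{0} \<in> J" "{1} \<in> J" using k by (auto simp: I_def)
    then show ?thesis using k by (intro disjI1 exI[of _ 0] conjI exI[of _ 1]) auto
  qed
qed

section \<open>Rainbow edges under a vertex colouring\<close>

text \<open>Averaging over all colourings.\<close>

lemma rainbow_colouring:
  fixes F :: "'a set set"
  assumes F: "finite F" "\<And>e. e \<in> F \<Longrightarrow> finite e \<and> card e = k" and k: "k \<ge> 1"
  shows "\<exists>\<chi>. card F \<le> k ^ k * card {e \<in> F. bij_betw \<chi> e {..<k}}"
proof (rule ccontr)
  assume "\<not> ?thesis"
  then have lt: "k ^ k * card {e \<in> F. bij_betw \<chi> e {..<k}} < card F" for \<chi>
    by (simp add: not_le)
  define V where "V = \<Union>F"
  define \<Phi> where "\<Phi> = V \<rightarrow>\<^sub>E {..<k}"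
  have finV: "finite V" using F by (auto simp: V_def)
  have fin\<Phi>: "finite \<Phi>" unfolding \<Phi>_def using finV by (intro finite_PiE) auto
  have card\<Phi>: "card \<Phi> = k ^ card V" unfolding \<Phi>_def using finV by (simp add: card_PiE)
  have ne: "\<Phi> \<noteq> {}" using card\<Phi> k by auto
  have many: "k ^ card V \<le> k ^ k * card {\<chi> \<in> \<Phi>. bij_betw \<chi> e {..<k}}" if e: "e \<in> F" for e
  proof -
    have eV: "e \<subseteq> V" using e by (auto simp: V_def)
    obtain b where b: "bij_betw b e {..<k}"
      using F(2)[OF e] by (metis card_lessThan finite_lessThan finite_same_card_bij)
    \<comment> \<open>Colourings that extend one fixed bijection on \<open>e\<close> already make up
      the fraction \<open>1 / k ^ k\<close>; the other bijections are given away.\<close>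
    let ?P = "PiE V (\<lambda>x. if x \<in> e then {b x} else {..<k})"
    have "?P \<subseteq> {\<chi> \<in> \<Phi>. bij_betw \<chi> e {..<k}}"
    proof
      fix \<chi> assume \<chi>: "\<chi> \<in> ?P"
      have "\<chi> x = b x" if "x \<in> e" for x using PiE_mem[OF \<chi>, of x] that eV by auto
      then have "bij_betw \<chi> e {..<k}" using b by (simp cong: bij_betw_cong)
      moreover have "?P \<subseteq> \<Phi>" unfolding \<Phi>_def
        by (rule PiE_mono) (use b in \<open>auto simp: bij_betw_def\<close>)
      ultimately show "\<chi> \<in> {\<chi> \<in> \<Phi>. bij_betw \<chi> e {..<k}}" using \<chi> by blast
    qed
    then have "card ?P \<le> card {\<chi> \<in> \<Phi>. bij_betw \<chi> e {..<k}}"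
      using fin\<Phi> by (intro card_mono) auto
    moreover have "card ?P = k ^ (card V - k)"
    proof -
      have "card ?P = (\<Prod>x\<in>V. if x \<in> e then 1 else k)"
        using finV by (simp add: card_PiE if_distrib cong: if_cong)
      also have "\<dots> = (\<Prod>x\<in>V - e. k)"
        using finV by (intro prod.mono_neutral_cong_right) auto
      finally show ?thesis using F(2)[OF e] eV by (simp add: card_Diff_subset)
    qed
    moreover have "k \<le> card V" using F(2)[OF e] eV finV card_mono by metis
    then have "k ^ card V = k ^ k * k ^ (card V - k)" by (simp flip: power_add)
    ultimately show ?thesis by simp
  qed
  have "k ^ card V * card F = (\<Sum>e\<in>F. k ^ card V)" by simp
  also have "\<dots> \<le> (\<Sum>e\<in>F. k ^ k * card {\<chi> \<in> \<Phi>. bij_betw \<chi> e {..<k}})"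
    by (rule sum_mono[OF many])
  also have "\<dots> = k ^ k * (\<Sum>e\<in>F. \<Sum>\<chi>\<in>\<Phi>. if bij_betw \<chi> e {..<k} then 1 else 0)"
    using fin\<Phi> by (simp add: sum_distrib_left sum.If_cases Int_def)
  also have "\<dots> = k ^ k * (\<Sum>\<chi>\<in>\<Phi>. \<Sum>e\<in>F. if bij_betw \<chi> e {..<k} then 1 else 0)"
    by (subst sum.swap) simp
  also have "\<dots> = (\<Sum>\<chi>\<in>\<Phi>. k ^ k * card {e \<in> F. bij_betw \<chi> e {..<k}})"
    using F(1) by (simp add: sum_distrib_left sum.If_cases Int_def)
  also have "\<dots> < (\<Sum>\<chi>\<in>\<Phi>. card F)"
    by (rule sum_strict_mono[OF fin\<Phi> ne lt])
  also have "\<dots> = k ^ card V * card F" using card\<Phi> by simp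
  finally show False by simp
qed


section \<open>Centres of edges\<close>

definition centre :: "nat \<Rightarrow> 'a set set \<Rightarrow> 'a set \<Rightarrow> 'a \<Rightarrow> bool" where
  "centre Q F e c \<longleftrightarrow> c \<in> e \<and> rich Q F {c} \<and> (\<forall>y\<in>e. rich Q F {c, y})"

lemma centre_mono: "centre Q F e c \<Longrightarrow> F \<subseteq> G \<Longrightarrow> centre Q G e c"
  unfolding centre_def by (meson rich_mono)

lemma restr_rainbow_singleton:
  assumes "inj_on \<chi> e" "x \<in> e"
  shows "restr \<chi> e {\<chi> x} = {x}"
  using assms by (auto simp: restr_def dest: inj_onD)

lemma restr_rainbow_pair:
  assumes "inj_on \<chi> e" "x \<in> e" "y \<in> e"
  shows "restr \<chi> e {\<chi> x, \<chi> y} = {x, y}"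
  using assms by (auto simp: restr_def dest: inj_onD)

text \<open>By homogeneity a type that occurs is rich in every edge, so closure of \<open>J\<close>
  under intersection can be checked at the single edge \<open>e\<^sub>0\<close>. The bound
  \<open>2 * k \<le> Q\<close> allows a third edge to avoid two given ones.\<close>

lemma homogeneous_family_centre_or_path:
  fixes G :: "'a set set"
  assumes V: "finite V" "G \<subseteq> nsets V k" and rainbow: "\<And>e. e \<in> G \<Longrightarrow> bij_betw \<chi> e {..<k}"
    and hom: "\<And>A. A \<subseteq> {..<k} \<Longrightarrow> avoids_type \<chi> G A \<or> rich_type Q \<chi> G A"
    and big: "card G > card V choose (k - 2)" and k: "k \<ge> 4" and Q: "2 * k \<le> Q" "l * k \<le> Q"
  shows "(\<exists>e\<in>G. \<exists>c. centre Q G e c) \<or> (\<exists>e. path_seq G (Suc l) e)"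
proof -
  have inj: "inj_on \<chi> e" and im: "\<chi> ` e = {..<k}" if "e \<in> G" for e
    using rainbow[OF that] by (auto simp: bij_betw_def)
  have eV: "e \<subseteq> V" and fe: "finite e" and ce: "card e = k" if "e \<in> G" for e
    using subsetD[OF V(2) that] by (auto simp: nsets_def)
  have finG: "finite G" using V by (meson finite_imp_finite_nsets finite_subset)
  obtain e\<^sub>0 where e0: "e\<^sub>0 \<in> G" using big by fastforce
  define J where "J = {A \<in> Pow {..<k}. \<not> avoids_type \<chi> G A}"
  have JP: "J \<subseteq> Pow {..<k}" by (auto simp: J_def)
  have J_rich: "rich Q G (restr \<chi> e A)" if "A \<in> J" "e \<in> G" for A e
    using hom[of A] that by (auto simp: J_def rich_type_def)
  have J_mem: "\<chi> ` (e \<inter> f) \<in> J" if "e \<in> G" "f \<in> G" "e \<noteq> f" for e f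
    using that im[of e] by (auto simp: J_def avoids_type_def)
  have J_top: "A \<noteq> {..<k}" if "A \<in> J" for A
  proof
    assume A: "A = {..<k}"
    from that obtain e f where ef: "e \<in> G" "f \<in> G" "e \<noteq> f" "\<chi> ` (e \<inter> f) = A"
      by (auto simp: J_def avoids_type_def)
    have "k \<le> card (e \<inter> f)"
      using card_image_le[of "e \<inter> f" \<chi>] ef A fe[OF ef(1)] by simp
    then have "e \<inter> f = e" "e \<inter> f = f"
      using card_seteq[of e "e \<inter> f"] card_seteq[of f "e \<inter> f"] fe ce ef by auto
    then show False using ef(3) by simp
  qed
  \<comment> \<open>Choose \<open>f\<close> through the \<open>A\<close>-kernel of
    \<open>e\<^sub>0\<close> and then \<open>g\<close> through its \<open>B\<close>-kernel, each
    otherwise off the edges before it: they meet exactly in the kernel of type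
    \<open>A \<inter> B\<close>.\<close>
  have Int: "A \<inter> B \<in> J" if A: "A \<in> J" and B: "B \<in> J" for A B
  proof -
    have "\<exists>f\<in>G. restr \<chi> e\<^sub>0 A \<subseteq> f \<and> (f - restr \<chi> e\<^sub>0 A) \<inter> e\<^sub>0 = {}"
      using J_rich[OF A e0] fe[OF e0] ce[OF e0] Q by (intro richD) auto
    then obtain f where f: "f \<in> G" "restr \<chi> e\<^sub>0 A \<subseteq> f" "(f - restr \<chi> e\<^sub>0 A) \<inter> e\<^sub>0 = {}" by blast
    have "card (e\<^sub>0 \<union> f) \<le> Q" using card_Un_le[of e\<^sub>0 f] ce e0 f(1) Q by simp
    then have "\<exists>g\<in>G. restr \<chi> e\<^sub>0 B \<subseteq> g \<and> (g - restr \<chi> e\<^sub>0 B) \<inter> (e\<^sub>0 \<union> f) = {}"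
      using J_rich[OF B e0] fe[OF e0] fe[OF f(1)] by (intro richD) auto
    then obtain g where g: "g \<in> G" "restr \<chi> e\<^sub>0 B \<subseteq> g" "(g - restr \<chi> e\<^sub>0 B) \<inter> (e\<^sub>0 \<union> f) = {}" by blast
    have "g \<inter> f = restr \<chi> e\<^sub>0 (A \<inter> B)"
    proof (intro equalityI subsetI)
      fix x assume x: "x \<in> g \<inter> f"
      then have "x \<in> restr \<chi> e\<^sub>0 B" using g(3) by blast
      then have "x \<in> e\<^sub>0" "\<chi> x \<in> B" by (auto simp: restr_def)
      moreover have "x \<in> restr \<chi> e\<^sub>0 A" using f(3) x \<open>x \<in> e\<^sub>0\<close> by blast
      ultimately show "x \<in> restr \<chi> e\<^sub>0 (A \<inter> B)" by (auto simp: restr_def)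
    next
      fix x assume "x \<in> restr \<chi> e\<^sub>0 (A \<inter> B)"
      then have "x \<in> restr \<chi> e\<^sub>0 A" "x \<in> restr \<chi> e\<^sub>0 B" by (auto simp: restr_def)
      then show "x \<in> g \<inter> f" using f(2) g(2) by blast
    qed
    moreover have "\<chi> ` restr \<chi> e\<^sub>0 (A \<inter> B) = A \<inter> B"
    proof -
      have "A \<inter> B \<subseteq> \<chi> ` e\<^sub>0" using JP A im[OF e0] by blast
      then show ?thesis by (auto simp: restr_def)
    qed
    ultimately have AB: "\<chi> ` (g \<inter> f) = A \<inter> B" by simp
    have "g \<noteq> f"
    proof
      assume "g = f"
      then have "A \<inter> B = {..<k}" using AB im[OF f(1)] by simp
      moreover have "A \<subseteq> {..<k}" using JP A by auto
      ultimately have "A = {..<k}" by blast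
      then show False using J_top A by blast
    qed
    then show ?thesis using J_mem[OF g(1) f(1)] AB by simp
  qed
  \<comment> \<open>There are more edges than \<open>(k - 2)\<close>-sets of vertices, so two edges
    agree in the colours \<open>T\<close>.\<close>
  have cover: "\<exists>A\<in>J. T \<subseteq> A" if T: "T \<subseteq> {..<k}" "card T = k - 2" for T
  proof -
    have chi_T: "\<chi> ` restr \<chi> e T = T" if "e \<in> G" for e
      using im[OF that] T(1) by (auto simp: restr_def)
    have "restr \<chi> e T \<in> nsets V (k - 2)" if e: "e \<in> G" for e
    proof -
      have sub: "restr \<chi> e T \<subseteq> e" by (auto simp: restr_def)
      then have "card (restr \<chi> e T) = k - 2"
        using card_image[OF inj_on_subset[OF inj[OF e] sub]] chi_T[OF e] T(2) by simp
      then show ?thesis using sub eV[OF e] finite_subset[OF sub fe[OF e]] by (auto simp: nsets_def)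
    qed
    then have "(\<lambda>e. restr \<chi> e T) ` G \<subseteq> nsets V (k - 2)" by blast
    then have "card ((\<lambda>e. restr \<chi> e T) ` G) \<le> card V choose (k - 2)"
      using card_mono[OF finite_imp_finite_nsets[OF V(1)]] by (metis card_nsets)
    then have "\<not> inj_on (\<lambda>e. restr \<chi> e T) G" using pigeonhole big by (metis le_less_trans)
    then obtain e f where ef: "e \<in> G" "f \<in> G" "e \<noteq> f" "restr \<chi> e T = restr \<chi> f T"
      unfolding inj_on_def by meson
    have "restr \<chi> e T \<subseteq> e \<inter> f" using ef(4) by (auto simp: restr_def)
    then have "T \<subseteq> \<chi> ` (e \<inter> f)" using chi_T[OF ef(1)] by (metis image_mono)
    then show ?thesis using J_mem[OF ef(1-3)] by meson
  qed
  have "{..<k} \<notin> J" using J_top by blast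
  from Int_closed_types[OF JP this Int cover k]
  show ?thesis
  proof
    assume "\<exists>a<k. \<exists>b<k. a \<noteq> b \<and> {a} \<in> J \<and> {b} \<in> J"
    then obtain a b where ab: "a < k" "b < k" "a \<noteq> b" "{a} \<in> J" "{b} \<in> J" by blast
    have "\<exists>x\<in>e. \<exists>y\<in>e. x \<noteq> y \<and> rich Q G {x} \<and> rich Q G {y}" if e: "e \<in> G" for e
    proof -
      obtain x y where xy: "x \<in> e" "y \<in> e" "\<chi> x = a" "\<chi> y = b"
        using im[OF e] ab by (metis imageE lessThan_iff)
      then have "rich Q G {x}" "rich Q G {y}"
        using J_rich[OF ab(4) e] J_rich[OF ab(5) e] restr_rainbow_singleton[OF inj[OF e]] by metis+
      moreover have "x \<noteq> y" using xy ab(3) by auto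
      ultimately show ?thesis using xy by meson
    qed
    then have "\<exists>e y. path_seq G (Suc l) e \<and> y \<in> e l \<and> rich Q G {y} \<and> (\<forall>i<l. y \<notin> e i)"
      using e0 fe ce by (intro two_rich_vertices_path_seq[OF _ _ _ Q(2)]) auto
    then show ?thesis by meson
  next
    assume "\<exists>m<k. {m} \<in> J \<and> (\<forall>j<k. {m, j} \<in> J)"
    then obtain m where m: "m < k" "{m} \<in> J" "\<And>j. j < k \<Longrightarrow> {m, j} \<in> J" by blast
    obtain x where x: "x \<in> e\<^sub>0" "\<chi> x = m" using im[OF e0] m(1) by (metis imageE lessThan_iff)
    have "rich Q G {x}"
      using J_rich[OF m(2) e0] restr_rainbow_singleton[OF inj[OF e0] x(1)] x(2) by simp
    moreover have "rich Q G {x, y}" if "y \<in> e\<^sub>0" for y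
    proof -
      have "\<chi> y < k" using im[OF e0] that by blast
      then show ?thesis
        using J_rich[OF m(3) e0, of "\<chi> y"] restr_rainbow_pair[OF inj[OF e0] x(1) that] x(2) by simp
    qed
    ultimately have "centre Q G e\<^sub>0 x" using x by (simp add: centre_def)
    then show ?thesis using e0 by blast
  qed
qed

text \<open>A homogeneous part \<open>G\<close> of the centreless edges must be small, since a
  centre in \<open>G\<close> would be a centre in \<open>F\<close>. The constant multiplies
  \<open>k ^ k\<close> for the colouring by the loss for \<open>2 ^ k\<close> types.\<close>

lemma few_edges_without_centre:
  fixes F :: "'a set set"
  assumes V: "finite V" "F \<subseteq> nsets V k" and k: "k \<ge> 4" and Q: "2 * k \<le> Q" "l * k \<le> Q"
    and no_path: "\<nexists>e. path_seq F (Suc l) e"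
  shows "card {e \<in> F. \<nexists>c. centre Q F e c}
    \<le> k ^ k * ((2 ^ k + 1) * (Q + 1)) ^ (2 ^ k + 1) * (card V choose (k - 2))"
proof -
  define F\<^sub>0 where "F\<^sub>0 = {e \<in> F. \<nexists>c. centre Q F e c}"
  have sub: "F\<^sub>0 \<subseteq> F" by (auto simp: F\<^sub>0_def)
  have finF: "finite F" using V by (meson finite_imp_finite_nsets finite_subset)
  have fin: "finite F\<^sub>0" using sub finF by (rule finite_subset)
  have fe: "finite e \<and> card e = k" if "e \<in> F\<^sub>0" for e
    using subsetD[OF V(2) subsetD[OF sub that]] by (simp add: nsets_def)
  obtain \<chi> where \<chi>: "card F\<^sub>0 \<le> k ^ k * card {e \<in> F\<^sub>0. bij_betw \<chi> e {..<k}}"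
    using rainbow_colouring[OF fin fe] k by auto
  define F\<^sub>1 where "F\<^sub>1 = {e \<in> F\<^sub>0. bij_betw \<chi> e {..<k}}"
  let ?c = "(2 ^ k + 1) * (Q + 1)"
  have c: "(card (Pow {..<k}) + 1) * (Q + 1) \<le> ?c" by (simp add: card_Pow)
  have fin1: "finite F\<^sub>1" using fin by (simp add: F\<^sub>1_def)
  have inj1: "inj_on \<chi> e" if "e \<in> F\<^sub>1" for e using that by (auto simp: F\<^sub>1_def bij_betw_def)
  have "\<exists>G\<subseteq>F\<^sub>1. card F\<^sub>1 \<le> ?c ^ (card (Pow {..<k}) + 1) * card G \<and>
     (\<forall>A\<in>Pow {..<k}. avoids_type \<chi> G A \<or> rich_type Q \<chi> G A)"
    by (rule homogeneous_subfamily[OF fin1 inj1 _ c]) auto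
  then obtain G where G: "G \<subseteq> F\<^sub>1" "card F\<^sub>1 \<le> ?c ^ (2 ^ k + 1) * card G"
     "\<And>A. A \<subseteq> {..<k} \<Longrightarrow> avoids_type \<chi> G A \<or> rich_type Q \<chi> G A"
    by (auto simp: card_Pow)
  have GF0: "G \<subseteq> F\<^sub>0" using G(1) by (auto simp: F\<^sub>1_def)
  have GF: "G \<subseteq> F" using GF0 sub by simp
  have "card G \<le> card V choose (k - 2)"
  proof (rule ccontr)
    assume big: "\<not> ?thesis"
    have "(\<exists>e\<in>G. \<exists>c. centre Q G e c) \<or> (\<exists>e. path_seq G (Suc l) e)"
    proof (rule homogeneous_family_centre_or_path[OF V(1) _ _ G(3) _ k Q])
      show "G \<subseteq> nsets V k" using GF V(2) by simp
      show "bij_betw \<chi> e {..<k}" if "e \<in> G" for e using that G(1) by (auto simp: F\<^sub>1_def)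
      show "card V choose (k - 2) < card G" using big by simp
    qed
    then show False
    proof
      assume "\<exists>e\<in>G. \<exists>c. centre Q G e c"
      then obtain e c where ec: "e \<in> G" "centre Q G e c" by blast
      then have "centre Q F e c" using centre_mono GF by metis
      then show False using ec(1) GF0 by (auto simp: F\<^sub>0_def)
    next
      assume "\<exists>e. path_seq G (Suc l) e"
      then show False using no_path path_seq_mono[OF _ GF order_refl] by metis
    qed
  qed
  then have "card F\<^sub>1 \<le> ?c ^ (2 ^ k + 1) * (card V choose (k - 2))"
    using G(2) by (meson le_trans mult_le_mono2)
  then have "card F\<^sub>0 \<le> k ^ k * (?c ^ (2 ^ k + 1) * (card V choose (k - 2)))"
    using \<chi> unfolding F\<^sub>1_def[symmetric] by (meson le_trans mult_le_mono2)
  then show ?thesis by (simp only: F\<^sub>0_def mult.assoc)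
qed


section \<open>The graph of rich pairs\<close>

text \<open>Deleting a vertex of degree at most \<open>d\<close> loses at most \<open>d\<close>
  pairs and one vertex, so the inequality persists and the process stops before the relation is
  empty. The two coordinates count as separate sides even where they share elements.\<close>

lemma min_degree_subrelation:
  fixes E :: "('a \<times> 'b) set"
  assumes "finite E" "card E > d * (card (fst ` E) + card (snd ` E))"
  shows "\<exists>H\<subseteq>E. H \<noteq> {} \<and> (\<forall>x\<in>fst ` H. card {y. (x, y) \<in> H} > d) \<and> (\<forall>y\<in>snd ` H. card {x. (x, y) \<in> H} > d)"
  using assms
proof (induction "card E" arbitrary: E rule: less_induct)
  case less
  have del: ?case
    if D: "D \<subseteq> E" "D \<noteq> {}" "card D \<le> d"
      and cards: "card (fst ` (E - D)) + card (snd ` (E - D)) + 1 \<le> card (fst ` E) + card (snd ` E)" for D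
  proof -
    have finD: "finite D" using D(1) less.prems(1) by (rule finite_subset)
    have cE: "card (E - D) = card E - card D" "card D \<le> card E" "card D > 0"
      using D finD less.prems(1) card_Diff_subset[OF finD D(1)] card_mono[OF less.prems(1) D(1)]
      by (simp_all add: card_gt_0_iff)
    have lt: "card (E - D) < card E" using cE by simp
    have "d * (card (fst ` (E - D)) + card (snd ` (E - D))) + d \<le> d * (card (fst ` E) + card (snd ` E))"
      using mult_le_mono2[OF cards, of d] by (simp add: distrib_left)
    then have "d * (card (fst ` (E - D)) + card (snd ` (E - D))) < card (E - D)"
      using less.prems(2) cE D(3) by linarith
    from less.hyps[OF lt _ this] less.prems(1)
    show ?thesis by (meson Diff_subset finite_Diff order_trans)
  qed
  show ?case
  proof (cases "(\<forall>x\<in>fst ` E. card {y. (x, y) \<in> E} > d) \<and> (\<forall>y\<in>snd ` E. card {x. (x, y) \<in> E} > d)")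
    case True
    then show ?thesis using less.prems(2) by (intro exI[of _ E]) auto
  next
    case False
    then consider x where "x \<in> fst ` E" "card {y. (x, y) \<in> E} \<le> d"
      | y where "y \<in> snd ` E" "card {x. (x, y) \<in> E} \<le> d"
      by (meson not_le)
    then show ?thesis
    proof cases
      case (1 x)
      define D where "D = {p \<in> E. fst p = x}"
      have "D = Pair x ` {y. (x, y) \<in> E}" by (auto simp: D_def image_iff)
      then have cD: "card D \<le> d" using 1(2) by (simp add: card_image inj_on_def)
      have "fst ` (E - D) \<subseteq> fst ` E - {x}" by (auto simp: D_def)
      then have "card (fst ` (E - D)) \<le> card (fst ` E) - 1"
        using card_mono[of "fst ` E - {x}" "fst ` (E - D)"] less.prems(1) 1(1) by simp
      moreover have "card (fst ` E) > 0" using 1(1) less.prems(1) card_gt_0_iff by blast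
      moreover have "card (snd ` (E - D)) \<le> card (snd ` E)"
        using less.prems(1) by (intro card_mono) auto
      ultimately have "card (fst ` (E - D)) + card (snd ` (E - D)) + 1 \<le> card (fst ` E) + card (snd ` E)"
        by linarith
      moreover have "D \<noteq> {}" "D \<subseteq> E" using 1(1) by (auto simp: D_def)
      ultimately show ?thesis using del cD by simp
    next
      case (2 y)
      define D where "D = {p \<in> E. snd p = y}"
      have "D = (\<lambda>x. (x, y)) ` {x. (x, y) \<in> E}" by (auto simp: D_def image_iff)
      then have cD: "card D \<le> d" using 2(2) by (simp add: card_image inj_on_def)
      have "snd ` (E - D) \<subseteq> snd ` E - {y}" by (auto simp: D_def)
      then have "card (snd ` (E - D)) \<le> card (snd ` E) - 1"
        using card_mono[of "snd ` E - {y}" "snd ` (E - D)"] less.prems(1) 2(1) by simp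
      moreover have "card (snd ` E) > 0" using 2(1) less.prems(1) card_gt_0_iff by blast
      moreover have "card (fst ` (E - D)) \<le> card (fst ` E)"
        using less.prems(1) by (intro card_mono) auto
      ultimately have "card (fst ` (E - D)) + card (snd ` (E - D)) + 1 \<le> card (fst ` E) + card (snd ` E)"
        by linarith
      moreover have "D \<noteq> {}" "D \<subseteq> E" using 2(1) by (auto simp: D_def)
      ultimately show ?thesis using del cD by simp
    qed
  qed
qed

section \<open>Alternating paths and distinct representatives\<close>

lemma ex_notin_finite:
  assumes "finite Z" "card Z < card X"
  shows "\<exists>x\<in>X. x \<notin> Z"
  using assms card_mono[of Z X] by (meson not_le subsetI)

text \<open>The endpoint always has more neighbours than there are vertices used so far, on both
  sides together. Starting on the first side makes a path with an even number of steps end there as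
  well.\<close>

lemma alternating_path:
  fixes H :: "('a \<times> 'a) set"
  assumes H: "H \<noteq> {}" and deg1: "\<And>x. x \<in> fst ` H \<Longrightarrow> card {y. (x, y) \<in> H} > d"
    and deg2: "\<And>y. y \<in> snd ` H \<Longrightarrow> card {x. (x, y) \<in> H} > d" and "m \<le> d"
  shows "\<exists>w. inj_on w {..m} \<and> (\<forall>i\<le>m. w i \<in> (if even i then fst ` H else snd ` H)) \<and>
     (\<forall>i<m. if even i then (w i, w (Suc i)) \<in> H else (w (Suc i), w i) \<in> H)"
  using \<open>m \<le> d\<close>
proof (induction m)
  case 0
  obtain x where "x \<in> fst ` H" using H by fastforce
  then show ?case by (intro exI[of _ "\<lambda>_. x"]) simp
next
  case (Suc m)
  then obtain w where w: "inj_on w {..m}" "\<And>i. i \<le> m \<Longrightarrow> w i \<in> (if even i then fst ` H else snd ` H)"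
     "\<And>i. i < m \<Longrightarrow> if even i then (w i, w (Suc i)) \<in> H else (w (Suc i), w i) \<in> H"
    by auto
  define X where "X = (if even m then {y. (w m, y) \<in> H} else {x. (x, w m) \<in> H})"
  have "card X > d" using w(2)[of m] deg1[of "w m"] deg2[of "w m"] by (auto simp: X_def)
  moreover have "card (w ` {..m}) \<le> d" using card_image_le[of "{..m}" w] Suc.prems by simp
  ultimately obtain z where z: "z \<in> X" "z \<notin> w ` {..m}"
    using ex_notin_finite[of "w ` {..m}" X] by auto
  define u where "u = w(Suc m := z)"
  have u: "u i = w i" if "i \<le> m" for i using that by (simp add: u_def)
  have uS: "u (Suc m) = z" by (simp add: u_def)
  have "inj_on u {..m}" using w(1) u inj_on_cong[of "{..m}" u w] by simp
  moreover have "u ` {..m} = w ` {..m}" using u by (intro image_cong) auto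
  ultimately have "inj_on u {..Suc m}" using z(2) uS by (simp add: atMost_Suc inj_on_insert)
  moreover have "u i \<in> (if even i then fst ` H else snd ` H)" if "i \<le> Suc m" for i
  proof (cases "i = Suc m")
    case True
    then show ?thesis using z(1) uS by (force simp: X_def image_iff split: if_splits)
  next
    case False
    then show ?thesis using w(2)[of i] u[of i] that by simp
  qed
  moreover have "if even i then (u i, u (Suc i)) \<in> H else (u (Suc i), u i) \<in> H" if "i < Suc m" for i
  proof (cases "i = m")
    case True
    then show ?thesis using z(1) uS u[of m] by (auto simp: X_def)
  next
    case False
    then show ?thesis using w(3)[of i] u[of i] u[of "Suc i"] that by simp
  qed
  ultimately show ?case by meson
qed

text \<open>Greedy: fewer than \<open>t\<close> representatives and the set \<open>Z\<close> are
  forbidden at each step. It supplies the vertices between consecutive centres, with the centres as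
  \<open>Z\<close>.\<close>

lemma distinct_representatives:
  assumes Z: "finite Z" and X: "\<And>i. i < t \<Longrightarrow> card (X i) \<ge> t + card Z"
  shows "\<exists>y::nat \<Rightarrow> 'a. inj_on y {..<t} \<and> (\<forall>i<t. y i \<in> X i - Z)"
proof -
  have "\<exists>y. inj_on y {..<s} \<and> (\<forall>i<s. y i \<in> X i - Z)" if "s \<le> t" for s
    using that
  proof (induction s)
    case 0
    then show ?case by simp
  next
    case (Suc s)
    then obtain y where y: "inj_on y {..<s}" "\<And>i. i < s \<Longrightarrow> y i \<in> X i - Z" by auto
    have "card (Z \<union> y ` {..<s}) \<le> card Z + s"
      using card_Un_le[of Z "y ` {..<s}"] card_image[OF y(1)] by simp
    then have "card (Z \<union> y ` {..<s}) < card (X s)" using X[of s] Suc.prems by simp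
    then obtain z where z: "z \<in> X s" "z \<notin> Z \<union> y ` {..<s}"
      using ex_notin_finite[of "Z \<union> y ` {..<s}" "X s"] Z by auto
    define u where "u = y(s := z)"
    have u: "u i = y i" if "i < s" for i using that by (simp add: u_def)
    have us: "u s = z" by (simp add: u_def)
    have "inj_on u {..<s}" using y(1) u inj_on_cong[of "{..<s}" u y] by simp
    moreover have "u ` {..<s} = y ` {..<s}" using u by (intro image_cong) auto
    ultimately have "inj_on u {..<Suc s}" using z(2) us by (simp add: lessThan_Suc inj_on_insert)
    moreover have "u i \<in> X i - Z" if "i < Suc s" for i
      using that y(2)[of i] z u[of i] us by (cases "i = s") auto
    ultimately show ?case by meson
  qed
  then show ?thesis by simp
qed

text \<open>The relation is directed: \<open>{c}\<close> must be rich but \<open>{y}\<close> need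
  not be, so walks have to start and end at centres.\<close>

definition nbhd :: "nat \<Rightarrow> 'a set set \<Rightarrow> 'a set \<Rightarrow> 'a \<Rightarrow> 'a set" where
  "nbhd Q F V c = {y \<in> V. y \<noteq> c \<and> rich Q F {c} \<and> rich Q F {c, y}}"

text \<open>The constant is \<open>2 * t\<close> for the minimum degree, which allows a walk of
  \<open>2 * t\<close> steps between two centres, times 2 because \<open>V\<close> occurs on both
  sides of the relation.\<close>

lemma sum_card_nbhd_le:
  assumes V: "finite V" "F \<subseteq> nsets V k" and k: "k \<ge> 2" and Q: "2 * (2 * t + 2) * k \<le> Q"
    and no_path: "\<nexists>e. path_seq F (2 * t + 2) e"
  shows "(\<Sum>c\<in>V. card (nbhd Q F V c)) \<le> 4 * t * card V"
proof (rule ccontr)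
  assume neg: "\<not> ?thesis"
  define E where "E = (SIGMA c:V. nbhd Q F V c)"
  have finN: "finite (nbhd Q F V c)" for c using V(1) by (simp add: nbhd_def)
  have fe: "finite e \<and> card e \<le> k" if "e \<in> F" for e
    using subsetD[OF V(2) that] by (simp add: nsets_def)
  have finE: "finite E" using V(1) finN by (simp add: E_def)
  have "fst ` E \<subseteq> V" "snd ` E \<subseteq> V" by (auto simp: E_def nbhd_def)
  then have "card (fst ` E) + card (snd ` E) \<le> card V + card V"
    using V(1) by (intro add_mono card_mono)
  then have "2 * t * (card (fst ` E) + card (snd ` E)) \<le> 2 * t * (card V + card V)"
    by (rule mult_le_mono2)
  also have "\<dots> < card E"
    using neg V(1) finN by (simp add: E_def not_le algebra_simps)
  finally have "card E > 2 * t * (card (fst ` E) + card (snd ` E))" .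
  from min_degree_subrelation[OF finE this]
  obtain H where H: "H \<subseteq> E" "H \<noteq> {}" "\<And>x. x \<in> fst ` H \<Longrightarrow> card {y. (x, y) \<in> H} > 2 * t"
    "\<And>y. y \<in> snd ` H \<Longrightarrow> card {x. (x, y) \<in> H} > 2 * t"
    by blast
  obtain w where w: "inj_on w {..2 * t}" "\<And>i. i \<le> 2 * t \<Longrightarrow> w i \<in> (if even i then fst ` H else snd ` H)"
    "\<And>i. i < 2 * t \<Longrightarrow> if even i then (w i, w (Suc i)) \<in> H else (w (Suc i), w i) \<in> H"
    using alternating_path[OF H(2-4) order_refl] by auto
  have Hr: "rich Q F {x}" "rich Q F {x, y}" if "(x, y) \<in> H" for x y
    using subsetD[OF H(1) that] by (auto simp: E_def nbhd_def)
  have "rich Q F {w 0}" "rich Q F {w (2 * t)}"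
    using w(2)[of 0] w(2)[of "2 * t"] Hr(1) by auto
  moreover have "rich Q F {w i, w (Suc i)}" if "i < 2 * t" for i
    using w(3)[OF that] Hr(2) by (metis insert_commute)
  ultimately have "\<exists>e. path_seq F (2 * t + 2) e"
    by (intro rich_walk_path_seq[OF fe k Q w(1)])
  then show False using no_path by simp
qed

text \<open>Linking \<open>t + 1\<close> centres takes \<open>t\<close> distinct common neighbours
  that are not among the centres; hence the threshold \<open>t + (t + 1)\<close>.\<close>

lemma no_large_common_nbhds:
  assumes V: "finite V" "F \<subseteq> nsets V k" and k: "k \<ge> 2" and Q: "2 * (2 * t + 2) * k \<le> Q"
    and no_path: "\<nexists>e. path_seq F (2 * t + 2) e" and t: "t \<ge> 1"
    and C: "card C = t + 1"
  shows "\<exists>c\<in>C. \<exists>c'\<in>C. c \<noteq> c' \<and> card (nbhd Q F V c \<inter> nbhd Q F V c') < 2 * t + 1"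
proof (rule ccontr)
  assume "\<not> ?thesis"
  then have big: "2 * t + 1 \<le> card (nbhd Q F V c \<inter> nbhd Q F V c')" if "c \<in> C" "c' \<in> C" "c \<noteq> c'" for c c'
    using that not_le by blast
  have fe: "finite e \<and> card e \<le> k" if "e \<in> F" for e
    using subsetD[OF V(2) that] by (simp add: nsets_def)
  have finC: "finite C" using C by (metis Suc_eq_plus1 card.infinite nat.distinct(1))
  obtain c where "bij_betw c {0..<card C} C" using ex_bij_betw_nat_finite[OF finC] by blast
  then have c: "inj_on c {..t}" "\<And>i. i \<le> t \<Longrightarrow> c i \<in> C"
    using C by (auto simp: bij_betw_def atLeast0LessThan lessThan_Suc_atMost)
  define X where "X = (\<lambda>i. nbhd Q F V (c i) \<inter> nbhd Q F V (c (Suc i)))"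
  have "t + card C \<le> card (X i)" if "i < t" for i
  proof -
    have "c i \<noteq> c (Suc i)" using inj_onD[OF c(1), of i "Suc i"] that by auto
    then show ?thesis using big[of "c i" "c (Suc i)"] c(2) that C by (simp add: X_def)
  qed
  from distinct_representatives[OF finC, of t X, OF this]
  obtain y where y: "inj_on y {..<t}" "\<And>i. i < t \<Longrightarrow> y i \<in> X i - C" by auto
  \<comment> \<open>The walk \<open>c 0, y 0, c 1, y 1, \<dots>, c t\<close>.\<close>
  define w where "w = (\<lambda>j. if even j then c (j div 2) else y (j div 2))"
  have inj: "inj_on w {..2 * t}"
  proof (rule inj_onI)
    fix i j assume ij: "i \<in> {..2 * t}" "j \<in> {..2 * t}" "w i = w j"
    \<comment> \<open>The vertices \<open>y i\<close> avoid the centres, so membership in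
      \<open>C\<close> reveals the parity of a position and injectivity can be checked on each
      parity alone.\<close>
    have C: "w l \<in> C \<longleftrightarrow> even l" if "l \<le> 2 * t" for l
    proof (cases "even l")
      case True
      then show ?thesis using c(2)[of "l div 2"] that by (simp add: w_def)
    next
      case False
      then have "l div 2 < t" using that by (auto elim: oddE)
      then show ?thesis using y(2)[of "l div 2"] False by (simp add: w_def)
    qed
    have par: "even i \<longleftrightarrow> even j" using C[of i] C[of j] ij by auto
    have "i div 2 = j div 2"
    proof (cases "even i")
      case True
      then show ?thesis using inj_onD[OF c(1), of "i div 2" "j div 2"] ij par by (auto simp: w_def)
    next
      case False
      then have "i div 2 < t" "j div 2 < t" using ij par by (auto elim!: oddE)
      then show ?thesis using inj_onD[OF y(1), of "i div 2" "j div 2"] ij par False by (auto simp: w_def)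
    qed
    then show "i = j" using par by (metis dvd_mult_div_cancel odd_two_times_div_two_succ)
  qed
  have Xr: "rich Q F {c i}" "rich Q F {c (Suc i)}" "rich Q F {c i, y i}" "rich Q F {y i, c (Suc i)}" if "i < t" for i
    using y(2)[OF that] by (auto simp: X_def nbhd_def insert_commute)
  have "rich Q F {w 0}" using Xr(1)[of 0] t by (simp add: w_def)
  moreover have "rich Q F {w (2 * t)}" using Xr(2)[of "t - 1"] t by (simp add: w_def)
  moreover have "rich Q F {w i, w (Suc i)}" if "i < 2 * t" for i
  proof (cases "even i")
    case True
    then have "i div 2 < t" using that by auto
    then show ?thesis using Xr(3)[of "i div 2"] True by (simp add: w_def)
  next
    case False
    then have "i div 2 < t" "Suc i div 2 = Suc (i div 2)" using that by (auto elim!: oddE)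
    then show ?thesis using Xr(4)[of "i div 2"] False by (simp add: w_def)
  qed
  ultimately have "\<exists>e. path_seq F (2 * t + 2) e"
    by (intro rich_walk_path_seq[OF fe k Q inj])
  then show False using no_path by simp
qed


section \<open>Counting edges by their centres\<close>

text \<open>Cleared of fractions, the ratio of the binomials is at most \<open>a / b\<close>:
  absorption extracts this factor, and the remaining ratio is at most 1.\<close>

lemma choose_ratio:
  assumes "a \<le> b" "j \<ge> 1"
  shows "b * (a choose j) \<le> a * (b choose j)"
proof -
  obtain i where j: "j = Suc i" using assms(2) by (cases j) auto
  have "Suc i * (b * (a choose j)) = b * (a * ((a - 1) choose i))"
    using binomial_absorption[of i a] by (simp add: j mult.left_commute)
  also have "\<dots> \<le> b * (a * ((b - 1) choose i))"
    using assms(1) by (intro mult_le_mono2 binomial_right_mono) simp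
  also have "\<dots> = a * (b * ((b - 1) choose i))" by (simp only: mult.left_commute)
  also have "\<dots> = Suc i * (a * (b choose j))"
    using binomial_absorption[of i b] by (simp add: j mult.left_commute)
  finally show ?thesis by (simp only: Suc_mult_le_cancel1)
qed

text \<open>For \<open>j \<ge> 2\<close> a second factor \<open>a / b\<close> can be extracted. This
  is the convexity used to compare vertex classes.\<close>

lemma choose_ratio_square:
  assumes "a \<le> b" "j \<ge> 2"
  shows "b\<^sup>2 * (a choose j) \<le> a\<^sup>2 * (b choose j)"
proof (cases a)
  case 0
  then show ?thesis using assms(2) by simp
next
  case (Suc a')
  obtain i where j: "j = Suc i" "i \<ge> 1" using assms(2) by (cases j) auto
  obtain b' where b: "b = Suc b'" "a' \<le> b'" using assms(1) Suc by (cases b) auto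
  have "b * (a' choose i) = b' * (a' choose i) + (a' choose i)" by (simp add: b)
  also have "\<dots> \<le> a' * (b' choose i) + (b' choose i)"
    using b(2) j(2) by (intro add_mono choose_ratio binomial_right_mono)
  also have "\<dots> = a * (b' choose i)" by (simp add: Suc)
  finally have le: "b * (a' choose i) \<le> a * (b' choose i)" .
  have absorb: "Suc i * (a choose j) = a * (a' choose i)" "Suc i * (b choose j) = b * (b' choose i)"
    using binomial_absorption[of i a] binomial_absorption[of i b] by (simp_all only: j Suc b diff_Suc_1)
  have "Suc i * (b\<^sup>2 * (a choose j)) = b\<^sup>2 * (Suc i * (a choose j))" by (simp only: mult.left_commute)
  also have "\<dots> = b * a * (b * (a' choose i))" by (simp only: absorb power2_eq_square mult_ac)
  also have "\<dots> \<le> b * a * (a * (b' choose i))" by (rule mult_le_mono2[OF le])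
  also have "\<dots> = a\<^sup>2 * (Suc i * (b choose j))" by (simp only: absorb power2_eq_square mult_ac)
  also have "\<dots> = Suc i * (a\<^sup>2 * (b choose j))" by (simp only: mult.left_commute)
  finally show ?thesis by (simp only: Suc_mult_le_cancel1)
qed

text \<open>Collects what the counting takes from path-freeness: \<open>sumN\<close> and
  \<open>common\<close>. Here \<open>m\<close> is \<open>k - 1\<close>, the size of an edge without
  its centre, and \<gamma> is the relative degree from which a vertex is a hub.\<close>

locale centred_family =
  fixes V :: "'a set" and F :: "'a set set" and N :: "'a \<Rightarrow> 'a set" and cen :: "'a set \<Rightarrow> 'a"
    and m t L K :: nat and \<gamma> :: real
  assumes finV: "finite V" and neV: "V \<noteq> {}" and m: "m \<ge> 2" and t: "t \<ge> 1" and \<gamma>: "\<gamma> > 0"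
    and F: "F \<subseteq> nsets V (Suc m)"
    and cen: "\<And>e. e \<in> F \<Longrightarrow> cen e \<in> e \<and> e - {cen e} \<subseteq> N (cen e)"
    and NV: "\<And>c. N c \<subseteq> V"
    and sumN: "(\<Sum>c\<in>V. card (N c)) \<le> K * card V"
    and common: "\<And>C. C \<subseteq> V \<Longrightarrow> card C = t + 1 \<Longrightarrow> \<exists>c\<in>C. \<exists>c'\<in>C. c \<noteq> c' \<and> card (N c \<inter> N c') < L"
begin

abbreviation n :: nat where "n \<equiv> card V"

definition Hubs :: "'a set" where "Hubs = {c \<in> V. \<gamma> * n \<le> card (N c)}"

definition W :: "'a set" where
  "W = (\<Union>p\<in>{p \<in> Hubs \<times> Hubs. fst p \<noteq> snd p \<and> card (N (fst p) \<inter> N (snd p)) < L}. N (fst p) \<inter> N (snd p))"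

definition hubs_of :: "'a set \<Rightarrow> 'a set" where "hubs_of S = {c \<in> Hubs. S \<subseteq> N c}"

definition vclass :: "'a set \<Rightarrow> 'a set" where "vclass T = {y \<in> V - W. hubs_of {y} = T}"

section \<open>Hubs, the exceptional set and the edges lost to them\<close>

lemma finN: "finite (N c)"
  using NV finV by (rule finite_subset)

lemma finF: "finite F"
  using F finV by (meson finite_imp_finite_nsets finite_subset)

lemma edge:
  assumes "e \<in> F"
  shows "cen e \<in> V" "e \<subseteq> V" "finite e" "card e = Suc m" "cen e \<in> e" "e - {cen e} \<subseteq> N (cen e)"
    "card (e - {cen e}) = m" "e = insert (cen e) (e - {cen e})"
  using subsetD[OF F assms] cen[OF assms] by (auto simp: nsets_def)

lemma edge_link: "e \<in> F \<Longrightarrow> e - {cen e} \<in> nsets (N (cen e)) m"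
  using edge(3)[of e] edge(6)[of e] edge(7)[of e] unfolding nsets_def by blast

lemma n_pos: "n > 0"
  using finV neV by (simp add: card_gt_0_iff)

lemma finHubs: "finite Hubs" and Hubs_V: "Hubs \<subseteq> V"
  using finV by (auto simp: Hubs_def)

lemma finW: "finite W"
  unfolding W_def using finN finHubs by auto

lemma fin_hubs_of: "finite (hubs_of S)"
  using finHubs by (simp add: hubs_of_def)

lemma card_Hubs: "\<gamma> * card Hubs \<le> K"
proof -
  have "\<gamma> * n * card Hubs = (\<Sum>c\<in>Hubs. \<gamma> * n)" by simp
  also have "\<dots> \<le> (\<Sum>c\<in>Hubs. real (card (N c)))" by (rule sum_mono) (simp add: Hubs_def)
  also have "\<dots> \<le> (\<Sum>c\<in>V. real (card (N c)))" using finV Hubs_V by (intro sum_mono2) auto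
  also have "\<dots> \<le> K * n" using sumN by (simp flip: of_nat_sum of_nat_mult)
  finally have "(\<gamma> * card Hubs) * n \<le> K * n" by (simp add: mult_ac)
  then show ?thesis using n_pos by simp
qed

lemma card_W: "card W \<le> card Hubs ^ 2 * L"
proof -
  let ?P = "{p \<in> Hubs \<times> Hubs. fst p \<noteq> snd p \<and> card (N (fst p) \<inter> N (snd p)) < L}"
  have fin: "finite ?P" using finHubs by simp
  have "card W \<le> (\<Sum>p\<in>?P. card (N (fst p) \<inter> N (snd p)))" unfolding W_def by (rule card_UN_le[OF fin])
  also have "\<dots> \<le> (\<Sum>p\<in>?P. L)" by (rule sum_mono) auto
  also have "\<dots> = card ?P * L" by simp
  also have "\<dots> \<le> card (Hubs \<times> Hubs) * L"
    using finHubs by (intro mult_le_mono1 card_mono) auto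
  finally show ?thesis by (simp add: power2_eq_square card_cartesian_product)
qed

text \<open>A centre of degree d has at most d^m links, and for a non-hub d^(m-1) is at most
  (\<gamma> n)^(m-1); the remaining factor d is summed by \<open>sumN\<close>. As
  \<open>m \<ge> 2\<close>, a small \<gamma> makes the bound small.\<close>

lemma card_edges_nonhub: "card {e \<in> F. cen e \<notin> Hubs} \<le> K * \<gamma> ^ (m - 1) * n ^ m"
proof -
  let ?E = "{e \<in> F. cen e \<notin> Hubs}" and ?f = "\<lambda>e. (cen e, e - {cen e})"
  let ?T = "SIGMA c:V - Hubs. nsets (N c) m"
  have inj: "inj_on ?f ?E"
    by (rule inj_onI) (metis (no_types, lifting) edge(8) mem_Collect_eq prod.inject)
  have "?f ` ?E \<subseteq> ?T" using edge(1) edge_link by blast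
  moreover have "finite ?T" using finV finN finite_imp_finite_nsets by blast
  ultimately have "card ?E \<le> card ?T" using inj card_inj_on_le by blast
  also have "card ?T = (\<Sum>c\<in>V - Hubs. card (N c) choose m)"
    using finV finite_imp_finite_nsets[OF finN] by (subst card_SigmaI) auto
  finally have "real (card ?E) \<le> (\<Sum>c\<in>V - Hubs. real (card (N c) choose m))"
    by (simp flip: of_nat_sum)
  also have "\<dots> \<le> (\<Sum>c\<in>V - Hubs. real (card (N c)) * (\<gamma> * n) ^ (m - 1))"
  proof (rule sum_mono)
    fix c assume c: "c \<in> V - Hubs"
    have "card (N c) choose m \<le> card (N c) ^ m"
      by (cases "m \<le> card (N c)") (simp_all add: binomial_le_pow binomial_eq_0)
    also have "\<dots> = card (N c) * card (N c) ^ (m - 1)" using m by (cases m) auto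
    finally have "real (card (N c) choose m) \<le> real (card (N c)) * real (card (N c)) ^ (m - 1)"
      by (simp flip: of_nat_power of_nat_mult)
    also have "\<dots> \<le> real (card (N c)) * (\<gamma> * n) ^ (m - 1)"
      using c by (intro mult_left_mono power_mono) (auto simp: Hubs_def)
    finally show "real (card (N c) choose m) \<le> real (card (N c)) * (\<gamma> * n) ^ (m - 1)" .
  qed
  also have "\<dots> = (\<Sum>c\<in>V - Hubs. real (card (N c))) * (\<gamma> * n) ^ (m - 1)"
    by (simp add: sum_distrib_right)
  also have "\<dots> \<le> (K * n) * (\<gamma> * n) ^ (m - 1)"
  proof (rule mult_right_mono)
    have "(\<Sum>c\<in>V - Hubs. real (card (N c))) \<le> (\<Sum>c\<in>V. real (card (N c)))"
      using finV by (intro sum_mono2) auto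
    also have "\<dots> \<le> K * n" using sumN by (simp flip: of_nat_sum of_nat_mult)
    finally show "(\<Sum>c\<in>V - Hubs. real (card (N c))) \<le> K * n" by simp
  qed (use \<gamma> in simp)
  also have "\<dots> = K * \<gamma> ^ (m - 1) * n ^ m"
    using m by (cases m) (auto simp: power_mult_distrib)
  finally show ?thesis .
qed

text \<open>Such an edge contains a hub and a different vertex of \<open>W\<close>, and a given pair
  lies in at most \<open>n choose (m - 1)\<close> edges.\<close>

lemma card_edges_W:
  "card {e \<in> F. cen e \<in> Hubs \<and> (e - {cen e}) \<inter> W \<noteq> {}} \<le> card Hubs * card W * (n choose (m - 1))"
proof -
  let ?X = "\<lambda>p. {e \<in> F. fst p \<in> e \<and> snd p \<in> e \<and> fst p \<noteq> snd p}"
  have "card (?X p) \<le> n choose (m - 1)" for p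
  proof -
    let ?f = "\<lambda>e. e - {fst p, snd p}"
    have "inj_on ?f (?X p)" by (rule inj_onI) blast
    moreover have "?f ` ?X p \<subseteq> nsets V (m - 1)"
    proof
      fix S assume "S \<in> ?f ` ?X p"
      then obtain e where e: "e \<in> ?X p" "S = e - {fst p, snd p}" by blast
      then have "e \<subseteq> V" "finite e" "card e = Suc m" using edge[of e] by auto
      then show "S \<in> nsets V (m - 1)" using e by (auto simp: nsets_def card_Diff_subset)
    qed
    ultimately have "card (?X p) \<le> card (nsets V (m - 1))"
      using finite_imp_finite_nsets[OF finV] by (meson card_inj_on_le)
    then show ?thesis by (simp add: card_nsets)
  qed
  note each = this
  have "{e \<in> F. cen e \<in> Hubs \<and> (e - {cen e}) \<inter> W \<noteq> {}} \<subseteq> (\<Union>p\<in>Hubs \<times> W. ?X p)"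
    using edge(5) by fastforce
  then have "card {e \<in> F. cen e \<in> Hubs \<and> (e - {cen e}) \<inter> W \<noteq> {}} \<le> card (\<Union>p\<in>Hubs \<times> W. ?X p)"
    using finHubs finW finF by (intro card_mono) auto
  also have "\<dots> \<le> (\<Sum>p\<in>Hubs \<times> W. card (?X p))" using finHubs finW by (intro card_UN_le) auto
  also have "\<dots> \<le> (\<Sum>p\<in>Hubs \<times> W. n choose (m - 1))" by (rule sum_mono) (rule each)
  finally show ?thesis by (simp add: card_cartesian_product)
qed

text \<open>Among \<open>t + 1\<close> hubs adjacent to \<open>y\<close>, two would have a small
  common neighbourhood by \<open>common\<close>, and this would put \<open>y\<close> into
  \<open>W\<close>.\<close>

lemma card_hubs_of_vertex:
  assumes y: "y \<in> V - W"
  shows "card (hubs_of {y}) \<le> t"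
proof (rule ccontr)
  assume "\<not> ?thesis"
  then obtain C where C: "C \<subseteq> hubs_of {y}" "card C = t + 1"
    by (metis Suc_eq_plus1 not_less_eq_eq obtain_subset_with_card_n)
  have CH: "C \<subseteq> Hubs" using C(1) by (auto simp: hubs_of_def)
  obtain c c' where c: "c \<in> C" "c' \<in> C" "c \<noteq> c'" "card (N c \<inter> N c') < L"
    using common[of C] CH Hubs_V C(2) by (meson order_trans)
  have "y \<in> N c" "y \<in> N c'" "(c, c') \<in> Hubs \<times> Hubs"
    using C(1) CH c by (auto simp: hubs_of_def)
  then have "y \<in> W" using c(3,4) unfolding W_def by force
  then show False using y by simp
qed

lemma hubs_of_subset: "y \<in> S \<Longrightarrow> hubs_of S \<subseteq> hubs_of {y}"
  by (auto simp: hubs_of_def)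

lemma card_hubs_of:
  assumes "S \<in> nsets (V - W) m"
  shows "card (hubs_of S) \<le> t"
proof -
  have "S \<noteq> {}" using assms m by (auto simp: nsets_def)
  then obtain y where y: "y \<in> S" by blast
  then have "y \<in> V - W" using assms by (auto simp: nsets_def)
  then show ?thesis
    using card_mono[OF fin_hubs_of hubs_of_subset[OF y]] card_hubs_of_vertex by (meson le_trans)
qed

section \<open>Edges centred at hubs and their links\<close>

definition hub_edges :: "'a set set" where
  "hub_edges = {e \<in> F. cen e \<in> Hubs \<and> (e - {cen e}) \<inter> W = {}}"

text \<open>An edge is recovered from its link and its centre, and the centre is one of the hubs of
  the link.\<close>

lemma hub_edges_inj:
  assumes "E \<subseteq> hub_edges"
  shows "card E \<le> (\<Sum>S\<in>(\<lambda>e. e - {cen e}) ` E. card (hubs_of S))"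
proof -
  let ?f = "\<lambda>e. (e - {cen e}, cen e)" and ?T = "SIGMA S:(\<lambda>e. e - {cen e}) ` E. hubs_of S"
  have EF: "E \<subseteq> F" using assms by (auto simp: hub_edges_def)
  have finE: "finite E" using EF finF by (rule finite_subset)
  have "inj_on ?f E"
    by (rule inj_onI) (metis (no_types, lifting) EF edge(8) prod.inject subsetD)
  moreover have "?f ` E \<subseteq> ?T"
    using assms edge(6) by (force simp: hub_edges_def hubs_of_def)
  moreover have "finite ?T" using finE fin_hubs_of by auto
  ultimately have "card E \<le> card ?T" by (meson card_inj_on_le)
  also have "\<dots> = (\<Sum>S\<in>(\<lambda>e. e - {cen e}) ` E. card (hubs_of S))"
    using finE fin_hubs_of by (intro card_SigmaI) auto
  finally show ?thesis .
qed

lemma hub_edges_link: "e \<in> hub_edges \<Longrightarrow> e - {cen e} \<in> nsets (V - W) m"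
  using edge[of e] by (auto simp: hub_edges_def nsets_def)

definition full :: "'a set set" where
  "full = {S \<in> nsets (V - W) m. card (hubs_of S) = t}"

text \<open>A link off \<open>W\<close> has at most \<open>t\<close> hubs, and at most
  \<open>t - 1\<close> unless it is full. A family of nearly \<open>t * (n choose m)\<close> edges
  therefore needs almost all \<open>m\<close>-sets to be full.\<close>

lemma card_hub_edges: "card hub_edges \<le> (t - 1) * (n choose m) + card full"
proof -
  let ?S = "nsets (V - W) m"
  have finS: "finite ?S" using finV finite_imp_finite_nsets by blast
  have "card hub_edges \<le> (\<Sum>S\<in>(\<lambda>e. e - {cen e}) ` hub_edges. card (hubs_of S))"
    by (rule hub_edges_inj) simp
  also have "\<dots> \<le> (\<Sum>S\<in>?S. card (hubs_of S))"
    using finS hub_edges_link by (intro sum_mono2) auto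
  also have "\<dots> \<le> (\<Sum>S\<in>?S. (t - 1) + (if card (hubs_of S) = t then 1 else 0))"
    by (rule sum_mono) (use card_hubs_of in fastforce)
  also have "\<dots> = card ?S * (t - 1) + card full"
    using finS by (simp add: sum.distrib full_def sum.If_cases Int_def)
  also have "card ?S * (t - 1) \<le> (t - 1) * (n choose m)"
    using finV by (simp add: card_nsets binomial_right_mono card_mono)
  finally show ?thesis by simp
qed

text \<open>The \<open>t\<close> hubs of a full set are hubs of each of its vertices, which have no
  others; so a full set lies inside one vertex class. If all classes were small, too few
  \<open>m\<close>-sets would lie inside classes.\<close>

lemma large_vclass:
  assumes "full \<noteq> {}"
  shows "\<exists>T\<subseteq>V. card T = t \<and> n * card full \<le> card (vclass T) * (n choose m)"
proof -
  let ?\<T> = "{T \<in> Pow Hubs. card T = t}"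
  have finT: "finite ?\<T>" using finHubs by simp
  have finC: "finite (vclass T)" for T using finV by (simp add: vclass_def)
  have full_class: "hubs_of S \<in> ?\<T> \<and> S \<in> nsets (vclass (hubs_of S)) m" if "S \<in> full" for S
  proof -
    from that have S: "S \<in> nsets (V - W) m" "card (hubs_of S) = t" by (auto simp: full_def)
    have "hubs_of {y} = hubs_of S" if y: "y \<in> S" for y
    proof -
      have "y \<in> V - W" using S(1) y by (auto simp: nsets_def)
      then show ?thesis
        using card_seteq[OF fin_hubs_of hubs_of_subset[OF y]] card_hubs_of_vertex[of y] S(2) by auto
    qed
    then have "S \<subseteq> vclass (hubs_of S)" using S(1) by (auto simp: vclass_def nsets_def)
    then show ?thesis using S by (auto simp: nsets_def hubs_of_def)
  qed
  then have "full \<subseteq> (\<Union>T\<in>?\<T>. nsets (vclass T) m)" by blast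
  moreover have "finite (\<Union>T\<in>?\<T>. nsets (vclass T) m)"
    using finT finC finite_imp_finite_nsets by blast
  ultimately have "card full \<le> card (\<Union>T\<in>?\<T>. nsets (vclass T) m)" by (intro card_mono)
  also have "\<dots> \<le> (\<Sum>T\<in>?\<T>. card (nsets (vclass T) m))" by (rule card_UN_le[OF finT])
  finally have le: "card full \<le> (\<Sum>T\<in>?\<T>. card (vclass T) choose m)" by (simp only: card_nsets)
  define v where "v = Max ((\<lambda>T. card (vclass T)) ` ?\<T>)"
  have "?\<T> \<noteq> {}" using assms full_class by blast
  then obtain T where T: "T \<in> ?\<T>" "v = card (vclass T)"
    using Max_in[of "(\<lambda>T. card (vclass T)) ` ?\<T>"] finT unfolding v_def by blast
  have v: "card (vclass T) \<le> v" if "T \<in> ?\<T>" for T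
    unfolding v_def using finT that by (intro Max_ge) auto
  \<comment> \<open>Exponent 2 suffices: one factor \<open>card (vclass T)\<close> is bounded by the
    maximum \<open>v\<close>, and the other sums to at most \<open>n\<close> over the disjoint
    classes.\<close>
  have "n\<^sup>2 * card full \<le> (\<Sum>T\<in>?\<T>. n\<^sup>2 * (card (vclass T) choose m))"
    using mult_le_mono2[OF le, of "n\<^sup>2"] by (simp only: sum_distrib_left)
  also have "\<dots> \<le> (\<Sum>T\<in>?\<T>. (card (vclass T))\<^sup>2 * (n choose m))"
    using finV m by (intro sum_mono choose_ratio_square card_mono) (auto simp: vclass_def)
  also have "\<dots> \<le> (\<Sum>T\<in>?\<T>. card (vclass T) * (v * (n choose m)))"
    by (rule sum_mono) (use v in \<open>auto simp: power2_eq_square intro: mult_le_mono\<close>)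
  also have "\<dots> = (\<Sum>T\<in>?\<T>. card (vclass T)) * (v * (n choose m))" by (simp only: sum_distrib_right)
  also have "\<dots> \<le> n * (v * (n choose m))"
  proof (rule mult_le_mono1)
    have "(\<Sum>T\<in>?\<T>. card (vclass T)) = card (\<Union>T\<in>?\<T>. vclass T)"
      using finT finC by (subst card_UN_disjoint) (auto simp: vclass_def)
    also have "\<dots> \<le> n" using finV by (intro card_mono) (auto simp: vclass_def)
    finally show "(\<Sum>T\<in>?\<T>. card (vclass T)) \<le> n" .
  qed
  finally have "n * (n * card full) \<le> n * (v * (n choose m))" by (simp add: power2_eq_square mult.assoc)
  then have "n * card full \<le> card (vclass T) * (n choose m)" using n_pos T(2) by simp
  moreover have "T \<subseteq> V" using T(1) Hubs_V by auto
  ultimately show ?thesis using T(1) by blast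
qed

text \<open>If the link contained a vertex of \<open>vclass T\<close>, the centre would be a hub of
  that vertex and hence lie in \<open>T\<close>. So the link avoids the class, and each link carries
  at most \<open>t\<close> edges.\<close>

lemma card_hub_edges_missing:
  "n * card {e \<in> hub_edges. e \<inter> T = {}} \<le> t * ((n - card (vclass T)) * (n choose m))"
proof -
  let ?E = "{e \<in> hub_edges. e \<inter> T = {}}" and ?S = "(\<lambda>e. e - {cen e})"
  have CV: "vclass T \<subseteq> V" by (auto simp: vclass_def)
  have sub: "?S ` ?E \<subseteq> nsets (V - vclass T) m"
  proof
    fix S assume "S \<in> ?S ` ?E"
    then obtain e where e: "e \<in> hub_edges" "e \<inter> T = {}" "S = e - {cen e}" by auto
    then have eF: "e \<in> F" "cen e \<in> Hubs" by (auto simp: hub_edges_def)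
    have "y \<notin> vclass T" if "y \<in> S" for y
    proof
      assume "y \<in> vclass T"
      moreover have "cen e \<in> hubs_of {y}" using that e(3) edge(6)[OF eF(1)] eF(2) by (auto simp: hubs_of_def)
      ultimately have "cen e \<in> T" by (auto simp: vclass_def)
      then show False using e(2) edge(5)[OF eF(1)] by blast
    qed
    then show "S \<in> nsets (V - vclass T) m" using hub_edges_link[OF e(1)] e(3) by (auto simp: nsets_def)
  qed
  have "card ?E \<le> (\<Sum>S\<in>?S ` ?E. card (hubs_of S))" by (rule hub_edges_inj) auto
  also have "\<dots> \<le> (\<Sum>S\<in>?S ` ?E. t)"
    by (rule sum_mono) (use card_hubs_of hub_edges_link in blast)
  also have "\<dots> \<le> t * card (nsets (V - vclass T) m)"
    using card_mono[OF finite_imp_finite_nsets sub] finV by simp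
  also have "\<dots> = t * ((n - card (vclass T)) choose m)"
    using CV finV by (simp add: card_nsets card_Diff_subset finite_subset)
  finally have "n * card ?E \<le> t * (n * ((n - card (vclass T)) choose m))"
    by (simp add: mult.left_commute)
  also have "\<dots> \<le> t * ((n - card (vclass T)) * (n choose m))"
    using m by (intro mult_le_mono2 choose_ratio) auto
  finally show ?thesis .
qed

text \<open>At least a fraction 1 - (\<delta> + \<eta>) of the \<open>m\<close>-sets is full, so one
  class \<open>vclass T\<close> contains that fraction of the vertices. The missed edges are the bad
  ones, plus at most \<open>t\<close> for each link off this class.\<close>

lemma stability:
  fixes \<delta> \<eta> :: real
  assumes bad: "card {e \<in> F. cen e \<notin> Hubs} + card {e \<in> F. cen e \<in> Hubs \<and> (e - {cen e}) \<inter> W \<noteq> {}}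
      \<le> \<eta> * (n choose m)"
    and large: "(t - \<delta>) * (n choose m) \<le> card F"
    and small: "\<delta> + \<eta> < 1" and mn: "m \<le> n"
  shows "\<exists>T\<subseteq>V. card T = t \<and> card {e \<in> F. e \<inter> T = {}} \<le> (\<eta> + t * (\<delta> + \<eta>)) * (n choose m)"
proof -
  let ?A = "{e \<in> F. cen e \<notin> Hubs}" and ?B = "{e \<in> F. cen e \<in> Hubs \<and> (e - {cen e}) \<inter> W \<noteq> {}}"
  let ?M = "real (n choose m)"
  have Mpos: "?M > 0" using mn by simp
  have union: "F = ?A \<union> ?B \<union> hub_edges" by (auto simp: hub_edges_def)
  have fin: "finite ?A" "finite ?B" "finite hub_edges" using finF by (auto simp: hub_edges_def)
  have "card F \<le> card ?A + card ?B + card hub_edges"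
    using card_Un_le[of "?A \<union> ?B" hub_edges] card_Un_le[of ?A ?B] union by simp
  then have "real (card F) \<le> \<eta> * ?M + card hub_edges" using bad by linarith
  moreover have "real (card hub_edges) \<le> (real t - 1) * ?M + card full"
  proof -
    have "real (card hub_edges) \<le> real ((t - 1) * (n choose m) + card full)"
      using card_hub_edges by linarith
    then show ?thesis using t by (simp add: of_nat_diff)
  qed
  ultimately have full: "(1 - (\<delta> + \<eta>)) * ?M \<le> card full" using large by (simp add: algebra_simps)
  have "0 < (1 - (\<delta> + \<eta>)) * ?M" using small Mpos by simp
  then have "full \<noteq> {}" using full by auto
  then obtain T where T: "T \<subseteq> V" "card T = t" "n * card full \<le> card (vclass T) * (n choose m)"
    using large_vclass by blast
  have "n * ((1 - (\<delta> + \<eta>)) * ?M) \<le> real n * card full" using full by (intro mult_left_mono) auto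
  also have "\<dots> \<le> card (vclass T) * ?M" using T(3) by (simp flip: of_nat_mult)
  finally have "((1 - (\<delta> + \<eta>)) * n) * ?M \<le> card (vclass T) * ?M" by (simp only: mult_ac)
  then have "(1 - (\<delta> + \<eta>)) * n \<le> card (vclass T)" using Mpos by simp
  moreover have "card (vclass T) \<le> n" using finV by (intro card_mono) (auto simp: vclass_def)
  ultimately have vc: "real (n - card (vclass T)) \<le> (\<delta> + \<eta>) * n" by (simp add: of_nat_diff algebra_simps)
  have "real n * card {e \<in> hub_edges. e \<inter> T = {}} \<le> t * (real (n - card (vclass T)) * ?M)"
    using card_hub_edges_missing[of T] by (simp flip: of_nat_mult)
  also have "\<dots> \<le> t * (((\<delta> + \<eta>) * n) * ?M)"
    using vc by (intro mult_left_mono mult_right_mono) auto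
  finally have "real n * card {e \<in> hub_edges. e \<inter> T = {}} \<le> real n * (t * (\<delta> + \<eta>) * ?M)"
    by (simp only: mult_ac)
  then have miss: "card {e \<in> hub_edges. e \<inter> T = {}} \<le> t * (\<delta> + \<eta>) * ?M" using n_pos by simp
  have "{e \<in> F. e \<inter> T = {}} \<subseteq> ?A \<union> ?B \<union> {e \<in> hub_edges. e \<inter> T = {}}"
    using union by blast
  then have "card {e \<in> F. e \<inter> T = {}} \<le> card (?A \<union> ?B \<union> {e \<in> hub_edges. e \<inter> T = {}})"
    using fin by (intro card_mono) auto
  also have "\<dots> \<le> card ?A + card ?B + card {e \<in> hub_edges. e \<inter> T = {}}"
    using card_Un_le[of "?A \<union> ?B" "{e \<in> hub_edges. e \<inter> T = {}}"] card_Un_le[of ?A ?B] by simp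
  finally have "real (card {e \<in> F. e \<inter> T = {}}) \<le> (\<eta> + t * (\<delta> + \<eta>)) * ?M"
    using bad miss by (simp add: distrib_right)
  then show ?thesis using T by blast
qed

end


section \<open>The stability theorem\<close>

text \<open>The ratio of the two coefficients is m / (n - m + 1). This turns the losses of order
  n^(k-2) into a small fraction of all \<open>m\<close>-sets.\<close>

lemma choose_pred_eventually_small:
  fixes \<kappa> :: real
  assumes \<kappa>: "\<kappa> > 0" and m: "m \<ge> 1"
  shows "\<exists>n\<^sub>0. \<forall>n\<ge>n\<^sub>0. m \<le> n \<and> real (n choose (m - 1)) \<le> \<kappa> * real (n choose m)"
proof -
  obtain j where j: "m = Suc j" using m by (cases m) auto
  define n\<^sub>0 where "n\<^sub>0 = m + nat \<lceil>m / \<kappa>\<rceil>"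
  have "m \<le> n \<and> real (n choose (m - 1)) \<le> \<kappa> * real (n choose m)" if n: "n \<ge> n\<^sub>0" for n
  proof
    show mn: "m \<le> n" using n by (simp add: n\<^sub>0_def)
    have "nat \<lceil>m / \<kappa>\<rceil> \<le> n - j" using n j unfolding n\<^sub>0_def by linarith
    then have "m / \<kappa> \<le> real (n - j)"
      using real_nat_ceiling_ge[of "m / \<kappa>"] of_nat_mono order_trans by blast
    then have "real m \<le> \<kappa> * real (n - j)" using \<kappa> by (simp add: field_simps)
    then have "real m * real (n choose j) \<le> \<kappa> * real (n - j) * real (n choose j)"
      by (intro mult_right_mono) auto
    also have "\<dots> = \<kappa> * real ((n - j) * (n choose j))" by simp
    also have "(n - j) * (n choose j) = m * (n choose m)"
      using binomial_absorb_comp[of n j] binomial_absorption[of j n] by (simp only: j)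
    also have "\<kappa> * real (m * (n choose m)) = real m * (\<kappa> * real (n choose m))" by simp
    finally show "real (n choose (m - 1)) \<le> \<kappa> * real (n choose m)" using j by simp
  qed
  then show ?thesis by blast
qed

lemma power_le_choose:
  assumes "m \<le> n"
  shows "real n ^ m \<le> real m ^ m * real (n choose m)"
proof (cases "m = 0")
  case False
  have "(real n / real m) ^ m \<le> real (n choose m)"
    using binomial_ge_n_over_k_pow_k[OF assms, where 'a=real] by simp
  then show ?thesis using False by (simp add: power_divide field_simps)
qed simp

text \<open>Non-hub centres and links meeting \<open>W\<close> take \<eta>/2 each. The cube arises
  because there are at most \<open>K / \<gamma>\<close> hubs and \<open>W\<close> has at most
  \<open>(K / \<gamma>)\<^sup>2 * L\<close> vertices.\<close>

lemma (in centred_family) few_bad_edges: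
  fixes \<eta> :: real
  assumes \<gamma>1: "\<gamma> \<le> 1" and \<gamma>2: "K * \<gamma> * m ^ m \<le> \<eta> / 2" and mn: "m \<le> n"
    and small: "(K / \<gamma>) ^ 3 * L * (n choose (m - 1)) \<le> \<eta> / 2 * (n choose m)"
  shows "card {e \<in> F. cen e \<notin> Hubs} + card {e \<in> F. cen e \<in> Hubs \<and> (e - {cen e}) \<inter> W \<noteq> {}}
      \<le> \<eta> * (n choose m)"
proof -
  have "\<gamma> ^ (m - 1) \<le> \<gamma>" using power_decreasing[of 1 "m - 1" \<gamma>] \<gamma>1 \<gamma> m by simp
  then have "K * \<gamma> ^ (m - 1) * n ^ m \<le> K * \<gamma> * n ^ m"
    by (intro mult_right_mono mult_left_mono) auto
  also have "\<dots> \<le> K * \<gamma> * (m ^ m * (n choose m))"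
    using power_le_choose[OF mn] \<gamma> by (intro mult_left_mono) auto
  also have "\<dots> \<le> \<eta> / 2 * (n choose m)"
    using mult_right_mono[OF \<gamma>2, of "real (n choose m)"] by (simp add: mult.assoc)
  finally have 1: "card {e \<in> F. cen e \<notin> Hubs} \<le> \<eta> / 2 * (n choose m)"
    using card_edges_nonhub by simp
  have H: "real (card Hubs) \<le> K / \<gamma>" using card_Hubs \<gamma> by (simp add: field_simps)
  note card_edges_W
  also have "card Hubs * card W * (n choose (m - 1)) \<le> card Hubs * (card Hubs ^ 2 * L) * (n choose (m - 1))"
    using card_W by (intro mult_le_mono1 mult_le_mono2)
  also have "\<dots> = card Hubs ^ 3 * L * (n choose (m - 1))"
    by (simp only: power3_eq_cube power2_eq_square mult.assoc)
  finally have "card {e \<in> F. cen e \<in> Hubs \<and> (e - {cen e}) \<inter> W \<noteq> {}}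
      \<le> card Hubs ^ 3 * L * (n choose (m - 1))" .
  then have "real (card {e \<in> F. cen e \<in> Hubs \<and> (e - {cen e}) \<inter> W \<noteq> {}})
      \<le> real (card Hubs) ^ 3 * L * (n choose (m - 1))"
    by (simp flip: of_nat_mult of_nat_power)
  also have "\<dots> \<le> (K / \<gamma>) ^ 3 * L * (n choose (m - 1))"
    using H by (intro mult_right_mono power_mono) auto
  also have "\<dots> \<le> \<eta> / 2 * (n choose m)" by (rule small)
  finally show ?thesis using 1 by simp
qed

lemma path_free_stability:
  fixes k t :: nat and \<epsilon> :: real
  assumes k: "k \<ge> 4" and t: "t \<ge> 1" and \<epsilon>: "\<epsilon> > 0"
  shows "\<exists>\<delta>::real. \<delta> > 0 \<and> (\<exists>n\<^sub>0::nat. \<forall>V::'a set. \<forall>F \<subseteq> nsets V k. finite V \<and> card V \<ge> n\<^sub>0 \<and>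
      (\<nexists>e. path_seq F (2 * t + 2) e) \<and> (real t - \<delta>) * (card V choose (k - 1)) \<le> card F \<longrightarrow>
      (\<exists>S\<subseteq>V. card S = t \<and> card {e \<in> F. e \<inter> S = {}} \<le> \<epsilon> * (card V choose (k - 1))))"
proof -
  define m where "m = k - 1"
  define Q where "Q = 2 * (2 * t + 2) * k"
  define K where "K = 4 * t"
  define L where "L = 2 * t + 1"
  define C\<^sub>1 where "C\<^sub>1 = k ^ k * ((2 ^ k + 1) * (Q + 1)) ^ (2 ^ k + 1)"
  \<comment> \<open>\<eta> also serves as \<delta>. Discarding centreless edges costs \<eta>, so the
    rest satisfies the density condition with 2\<eta>; the total loss is 2\<eta> + 3t\<eta>, at most
    5t\<eta>. The cap 1/4 keeps 3\<eta> below 1.\<close>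
  define \<eta> :: real where "\<eta> = min (\<epsilon> / (5 * t)) (1 / 4)"
  define \<gamma> :: real where "\<gamma> = min 1 (\<eta> / (2 * K * m ^ m))"
  define B :: real where "B = (K / \<gamma>) ^ 3 * L"
  \<comment> \<open>The first bound absorbs the centreless edges into \<eta>, the second the edges
    meeting \<open>W\<close> into \<eta>/2.\<close>
  define \<kappa> :: real where "\<kappa> = min (\<eta> / C\<^sub>1) (\<eta> / (2 * B))"
  have m: "m \<ge> 2" "k = Suc m" "k - 2 = m - 1" using k by (auto simp: m_def)
  have \<eta>: "\<eta> > 0" "\<eta> \<le> 1 / 4" "5 * t * \<eta> \<le> \<epsilon>"
    using \<epsilon> t by (auto simp: \<eta>_def min_def field_simps)
  have Km: "real K * m ^ m > 0" using t m(1) by (simp add: K_def)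
  have \<gamma>: "\<gamma> > 0" "\<gamma> \<le> 1" using \<eta>(1) Km by (auto simp: \<gamma>_def)
  have "\<gamma> \<le> \<eta> / (2 * K * m ^ m)" by (simp add: \<gamma>_def)
  then have \<gamma>K: "K * \<gamma> * m ^ m \<le> \<eta> / 2" using Km by (simp add: field_simps)
  have B: "B > 0" using \<gamma> t by (simp add: B_def K_def L_def)
  have "C\<^sub>1 > 0"
    unfolding C\<^sub>1_def using k by (intro mult_pos_pos zero_less_power) auto
  then have C1: "real C\<^sub>1 > 0" by simp
  have \<kappa>: "\<kappa> > 0" using \<eta>(1) B C1 by (simp add: \<kappa>_def)
  have "\<kappa> \<le> \<eta> / C\<^sub>1" "\<kappa> \<le> \<eta> / (2 * B)" by (simp_all add: \<kappa>_def)
  then have \<kappa>1: "C\<^sub>1 * \<kappa> \<le> \<eta>" and \<kappa>2: "B * \<kappa> \<le> \<eta> / 2" using B C1 by (simp_all add: field_simps)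
  obtain n\<^sub>0 where n0: "\<And>n. n \<ge> n\<^sub>0 \<Longrightarrow> m \<le> n \<and> real (n choose (m - 1)) \<le> \<kappa> * real (n choose m)"
    using choose_pred_eventually_small[OF \<kappa>, of m] m(1) by auto
  have main: "\<exists>S\<subseteq>V. card S = t \<and> card {e \<in> F. e \<inter> S = {}} \<le> \<epsilon> * (card V choose (k - 1))"
    if V: "finite V" "F \<subseteq> nsets V k" and n: "card V \<ge> n\<^sub>0" and no_path: "\<nexists>e. path_seq F (2 * t + 2) e"
      and large: "(real t - \<eta>) * (card V choose (k - 1)) \<le> card F" for V :: "'a set" and F
  proof -
    let ?M = "real (card V choose m)"
    have mn: "m \<le> card V" and small: "real (card V choose (m - 1)) \<le> \<kappa> * ?M"
      using n0[OF n] by auto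
    have C1small: "C\<^sub>1 * (card V choose (m - 1)) \<le> \<eta> * ?M"
      using mult_left_mono[OF small, of "real C\<^sub>1"] mult_right_mono[OF \<kappa>1, of ?M] by (simp add: mult.assoc)
    have "B * (card V choose (m - 1)) \<le> B * (\<kappa> * ?M)"
      using small B by (intro mult_left_mono) auto
    also have "\<dots> \<le> \<eta> / 2 * ?M"
      using mult_right_mono[OF \<kappa>2, of ?M] by (simp add: mult.assoc)
    finally have Bsmall: "B * (card V choose (m - 1)) \<le> \<eta> / 2 * ?M" .
    define cen where "cen = (\<lambda>e. SOME c. centre Q F e c)"
    define F\<^sub>0 where "F\<^sub>0 = {e \<in> F. \<nexists>c. centre Q F e c}"
    define F' where "F' = F - F\<^sub>0"
    have finF: "finite F" using V by (meson finite_imp_finite_nsets finite_subset)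
    \<comment> \<open>The length parameter is \<open>2 * t + 1\<close>, since the lemma excludes
      sequences of \<open>Suc l\<close> edges.\<close>
    have "card F\<^sub>0 \<le> C\<^sub>1 * (card V choose (k - 2))"
      unfolding F\<^sub>0_def C\<^sub>1_def
      by (rule few_edges_without_centre[OF V k, of Q "2 * t + 1"]) (use no_path in \<open>auto simp: Q_def\<close>)
    then have "real (card F\<^sub>0) \<le> real (C\<^sub>1 * (card V choose (m - 1)))" using m(3) by (metis of_nat_mono)
    then have F0: "real (card F\<^sub>0) \<le> \<eta> * ?M" using C1small by simp
    have cen: "centre Q F e (cen e)" if "e \<in> F'" for e
    proof -
      have "\<exists>c. centre Q F e c" using that by (auto simp: F'_def F\<^sub>0_def)
      then show ?thesis unfolding cen_def by (rule someI_ex)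
    qed
    \<comment> \<open>Edges come from \<open>F'\<close> but neighbourhoods are taken in
      \<open>F\<close>: removing \<open>F\<^sub>0\<close> might destroy richness.\<close>
    interpret fam: centred_family V F' "nbhd Q F V" cen m t L K \<gamma>
    proof
      show "V \<noteq> {}" using mn m(1) by auto
      show "F' \<subseteq> nsets V (Suc m)" using V(2) m(2) by (auto simp: F'_def)
      show "cen e \<in> e \<and> e - {cen e} \<subseteq> nbhd Q F V (cen e)" if "e \<in> F'" for e
      proof -
        have "e \<subseteq> V" using that V(2) by (auto simp: F'_def nsets_def)
        then show ?thesis using cen[OF that] by (auto simp: centre_def nbhd_def)
      qed
      show "nbhd Q F V c \<subseteq> V" for c by (auto simp: nbhd_def)
      show "(\<Sum>c\<in>V. card (nbhd Q F V c)) \<le> K * card V"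
        unfolding K_def using k by (intro sum_card_nbhd_le[OF V _ _ no_path]) (auto simp: Q_def)
      show "\<exists>c\<in>C. \<exists>c'\<in>C. c \<noteq> c' \<and> card (nbhd Q F V c \<inter> nbhd Q F V c') < L"
        if "C \<subseteq> V" "card C = t + 1" for C
        unfolding L_def using k t that(2)
        by (intro no_large_common_nbhds[OF V _ _ no_path]) (auto simp: Q_def)
    qed (use V m \<gamma> t in auto)
    have bad: "card {e \<in> F'. cen e \<notin> fam.Hubs} + card {e \<in> F'. cen e \<in> fam.Hubs \<and> (e - {cen e}) \<inter> fam.W \<noteq> {}} \<le> \<eta> * ?M"
      by (rule fam.few_bad_edges[OF \<gamma>(2) \<gamma>K mn]) (use Bsmall in \<open>simp add: B_def\<close>)
    have F': "card F = card F' + card F\<^sub>0"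
      using finF card_mono[of F F\<^sub>0] by (simp add: F'_def F\<^sub>0_def card_Diff_subset)
    then have "(t - 2 * \<eta>) * ?M \<le> card F'"
      using large[folded m_def] F0 by (simp add: algebra_simps)
    from fam.stability[OF bad this] \<eta>(2) mn
    obtain S where S: "S \<subseteq> V" "card S = t" "card {e \<in> F'. e \<inter> S = {}} \<le> (\<eta> + t * (2 * \<eta> + \<eta>)) * ?M"
      by auto
    have "{e \<in> F. e \<inter> S = {}} \<subseteq> F\<^sub>0 \<union> {e \<in> F'. e \<inter> S = {}}" by (auto simp: F'_def)
    then have "card {e \<in> F. e \<inter> S = {}} \<le> card (F\<^sub>0 \<union> {e \<in> F'. e \<inter> S = {}})"
      using finF by (intro card_mono) (auto simp: F'_def F\<^sub>0_def)
    also have "\<dots> \<le> card F\<^sub>0 + card {e \<in> F'. e \<inter> S = {}}" by (rule card_Un_le)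
    finally have "real (card {e \<in> F. e \<inter> S = {}}) \<le> (2 * \<eta> + 3 * t * \<eta>) * ?M"
      using F0 S(3) by (simp add: algebra_simps)
    also have "\<dots> \<le> \<epsilon> * ?M"
    proof (rule mult_right_mono)
      have "2 * \<eta> \<le> 2 * t * \<eta>" using t \<eta>(1) by simp
      then show "2 * \<eta> + 3 * t * \<eta> \<le> \<epsilon>" using \<eta>(3) by (simp add: algebra_simps)
    qed simp
    finally show ?thesis using S(1,2) by (auto simp: m_def)
  qed
  show ?thesis
  proof (rule exI[of _ \<eta>], intro conjI exI[of _ n\<^sub>0] allI impI)
    fix V :: "'a set" and F
    assume F: "F \<subseteq> nsets V k" and asm: "finite V \<and> n\<^sub>0 \<le> card V \<and>
      (\<nexists>e. path_seq F (2 * t + 2) e) \<and> (real t - \<eta>) * (card V choose (k - 1)) \<le> card F"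
    show "\<exists>S\<subseteq>V. card S = t \<and> card {e \<in> F. e \<inter> S = {}} \<le> \<epsilon> * (card V choose (k - 1))"
      using main[of V F, OF conjunct1[OF asm] F] asm by simp
  qed (rule \<eta>(1))
qed

theorem theorem5p1:
  fixes k t :: nat and \<epsilon> :: real
  assumes "k \<ge> 4" and "t \<ge> 1" and "\<epsilon> > 0"
  shows "\<exists>\<delta>::real. \<delta> > 0 \<and> (\<exists>n\<^sub>0::nat. \<forall>n\<ge>n\<^sub>0. \<forall>\<F> \<subseteq> nsets {1..n} k.
           (\<not> contains_linear_path k (2 * t + 2) \<F> \<or> \<not> contains_linear_path k (2 * t + 1) \<F>) \<and>
           real (card \<F>) \<ge> (real t - \<delta>) * real (n choose (k - 1)) \<longrightarrow>
           (\<exists>S \<subseteq> {1..n}. card S = t \<and>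
              real (card {A \<in> \<F>. A \<inter> S = {}}) \<le> \<epsilon> * real (n choose (k - 1))))"
proof -
  from path_free_stability[OF assms, where 'a=nat]
  obtain \<delta> :: real and n\<^sub>0 :: nat where \<delta>: "\<delta> > 0" and
    main: "\<forall>V :: nat set. \<forall>F \<subseteq> nsets V k. finite V \<and> card V \<ge> n\<^sub>0 \<and>
      (\<nexists>e. path_seq F (2 * t + 2) e) \<and> (real t - \<delta>) * (card V choose (k - 1)) \<le> card F \<longrightarrow>
      (\<exists>S\<subseteq>V. card S = t \<and> card {e \<in> F. e \<inter> S = {}} \<le> \<epsilon> * (card V choose (k - 1)))"
    by (elim exE conjE)
  have "\<exists>S \<subseteq> {1..n}. card S = t \<and> real (card {A \<in> \<F>. A \<inter> S = {}}) \<le> \<epsilon> * real (n choose (k - 1))"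
    if n: "n \<ge> n\<^sub>0" and F: "\<F> \<subseteq> nsets {1..n} k"
      and no: "\<not> contains_linear_path k (2 * t + 2) \<F> \<or> \<not> contains_linear_path k (2 * t + 1) \<F>"
      and large: "real (card \<F>) \<ge> (real t - \<delta>) * real (n choose (k - 1))" for n \<F>
  proof -
    \<comment> \<open>Dropping the last edge leaves a path of length \<open>2 * t + 1\<close>, so
      either alternative of the hypothesis excludes the longer sequence.\<close>
    have "\<not> path_seq \<F> (2 * t + 2) e" for e
    proof
      assume e: "path_seq \<F> (2 * t + 2) e"
      then have "path_seq \<F> (2 * t + 1) e" by (rule path_seq_mono) auto
      then show False using e no path_seq_imp_contains_linear_path[OF F] assms(1) by simp
    qed
    then show ?thesis using main[rule_format, OF F] n large by simp
  qed
  then show ?thesis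
    by (intro exI[of _ \<delta>] conjI exI[of _ n\<^sub>0] allI impI \<delta>) simp
qed

end
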